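(* Let $G$ be a graph. (i) Suppose that $F(G,4)\le 3$. Then $G$ is $\mathbb{Z}_3$-connected unless $G$ contains a bridge. (Thus, under the assumption $F(G,4)\le 3$, $G$ is $\mathbb{Z}_3$-connected if and only if $\kappa'(G)\ge 2$.) (ii) Suppose that $F(G,4)=0$. Then for every vertex $v\in V(G)$ with $d_G(v)\le 7$, if $\kappa'(G-v)\ge 2$, then $G$ is $\langle\mathbb{Z}_3\rangle$-extendable at $v$.
   Context: Graphs are finite, have no loops, and may have multiple edges. $F(G,k)$ denotes the minimum number of edges (possibly parallel to existing edges) that must be added to $G$, on the same vertex set, to obtain a supergraph with $k$ pairwise edge-disjoint spanning trees; in particular $F(G,k)=0$ if and only if $G$ has $k$ edge-disjoint spanning trees. A bridge is a cut-edge. $\kappa'(G)$ is the edge-connectivity; $\kappa'(G)\ge 2$ means that $G$ is connected and has no bridge (a one-vertex graph counts as satisfying this). For an orientation $D$, $d_D^+(v)$ and $d_D^-(v)$ denote the out-degree and in-degree of $v$. A zero-sum function of $G$ is a map $\beta: V(G)\to\mathbb{Z}_3$ with $\sum_{v\in V(G)}\beta(v)=0$ in $\mathbb{Z}_3$; a $\beta$-orientation of $G$ is an orientation $D$ of $G$ with $d_D^+(v)-d_D^-(v)=\beta(v)$ in $\mathbb{Z}_3$ for every $v\in V(G)$. $G$ is $\mathbb{Z}_3$-connected if it admits a $\beta$-orientation for every zero-sum function $\beta$ of $G$. $E_G(z_0)$ is the set of edges incident with $z_0$; a pre-orientation $D_{z_0}$ of $E_G(z_0)$ is an orientation of just these edges.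 $G$ is $\langle\mathbb{Z}_3\rangle$-extendable at $z_0$ if for every zero-sum function $\beta$ of $G$ and every pre-orientation $D_{z_0}$ of $E_G(z_0)$ with $d_{D_{z_0}}^+(z_0)-d_{D_{z_0}}^-(z_0)\equiv\beta(z_0)\pmod 3$, $D_{z_0}$ can be extended to a $\beta$-orientation of $G$. *)

theory Defs
  imports
    "Graph_Theory.Digraph"
    "HOL-Library.Numeral_Type"
    "HOL-Library.Extended_Nat"
begin

section \<open>Finite loopless multigraphs\<close>

text \<open>Edges are labels, so parallel edges are distinct labels with the same pair of ends.\<close>

record ('v, 'e) multigraph =
  vertices :: "'v set"
  edges :: "'e set"
  ends :: "'e \<Rightarrow> 'v set"

definition wf_multigraph :: "('v, 'e) multigraph \<Rightarrow> bool" where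
  "wf_multigraph G \<longleftrightarrow>
     finite (vertices G) \<and> vertices G \<noteq> {} \<and> finite (edges G) \<and>
     (\<forall>e \<in> edges G. ends G e \<subseteq> vertices G \<and> card (ends G e) = 2)"

definition incident_edges :: "('v, 'e) multigraph \<Rightarrow> 'v \<Rightarrow> 'e set" where
  "incident_edges G v = {e \<in> edges G. v \<in> ends G e}"

definition vertex_degree :: "('v, 'e) multigraph \<Rightarrow> 'v \<Rightarrow> nat" where
  "vertex_degree G v = card (incident_edges G v)"

definition delete_edges :: "('v, 'e) multigraph \<Rightarrow> 'e set \<Rightarrow> ('v, 'e) multigraph" where
  "delete_edges G S = G\<lparr>edges := edges G - S\<rparr>"

definition delete_vertex :: "('v, 'e) multigraph \<Rightarrow> 'v \<Rightarrow> ('v, 'e) multigraph" where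
  "delete_vertex G v =
     G\<lparr>vertices := vertices G - {v}, edges := edges G - incident_edges G v\<rparr>"


section \<open>Connectedness, bridges and edge-connectivity\<close>

definition adjacency :: "('v, 'e) multigraph \<Rightarrow> ('v \<times> 'v) set" where
  "adjacency G = {(u, v). \<exists>e \<in> edges G. ends G e = {u, v}}"

definition connected_graph :: "('v, 'e) multigraph \<Rightarrow> bool" where
  "connected_graph G \<longleftrightarrow>
     vertices G \<noteq> {} \<and> (\<forall>u \<in> vertices G. \<forall>v \<in> vertices G. (u, v) \<in> (adjacency G)\<^sup>*)"

definition graph_components :: "('v, 'e) multigraph \<Rightarrow> 'v set set" where
  "graph_components G = vertices G // (adjacency G)\<^sup>*"

definition bridge :: "('v, 'e) multigraph \<Rightarrow> 'e \<Rightarrow> bool" where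
  "bridge G e \<longleftrightarrow>
     e \<in> edges G \<and> card (graph_components (delete_edges G {e})) > card (graph_components G)"

text \<open>
  The infimum is taken in the extended naturals, so a one-vertex graph, which has no
  disconnecting edge set, gets the value infinity.
\<close>

definition edge_connectivity :: "('v, 'e) multigraph \<Rightarrow> enat" where
  "edge_connectivity G =
     (INF S \<in> {S. S \<subseteq> edges G \<and> \<not> connected_graph (delete_edges G S)}. enat (card S))"


section \<open>Packing spanning trees\<close>

text \<open>
  The edge \<open>es ! i\<close> of a cycle joins the cyclically consecutive vertices \<open>xs ! i\<close> and
  \<open>xs ! (i + 1)\<close>; two parallel edges form a cycle of length 2.
\<close>

definition graph_cycle :: "('v, 'e) multigraph \<Rightarrow> 'v list \<Rightarrow> 'e list \<Rightarrow> bool" where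
  "graph_cycle G xs es \<longleftrightarrow>
     length xs \<ge> 2 \<and> length es = length xs \<and>
     distinct xs \<and> distinct es \<and> set xs \<subseteq> vertices G \<and> set es \<subseteq> edges G \<and>
     (\<forall>i < length xs. ends G (es ! i) = {xs ! i, xs ! (Suc i mod length xs)})"

definition tree :: "('v, 'e) multigraph \<Rightarrow> bool" where
  "tree G \<longleftrightarrow> connected_graph G \<and> (\<nexists>xs es. graph_cycle G xs es)"

text \<open>A spanning tree is given by its edge set.\<close>

definition spanning_tree :: "('v, 'e) multigraph \<Rightarrow> 'e set \<Rightarrow> bool" where
  "spanning_tree G T \<longleftrightarrow> T \<subseteq> edges G \<and> tree (G\<lparr>edges := T\<rparr>)"

definition disjoint_spanning_trees :: "('v, 'e) multigraph \<Rightarrow> nat \<Rightarrow> bool" where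
  "disjoint_spanning_trees G k \<longleftrightarrow>
     (\<exists>T :: nat \<Rightarrow> 'e set. (\<forall>i < k. spanning_tree G (T i)) \<and>
        (\<forall>i < k. \<forall>j < k. i \<noteq> j \<longrightarrow> T i \<inter> T j = {}))"

text \<open>
  New edges are listed by their pairs of ends; the \<open>i\<close>-th one gets the fresh label \<open>Inr i\<close>.
\<close>

definition add_edges ::
  "('v, 'e) multigraph \<Rightarrow> 'v set list \<Rightarrow> ('v, 'e + nat) multigraph" where
  "add_edges G ps =
     \<lparr>vertices = vertices G,
      edges = Inl ` edges G \<union> Inr ` {..<length ps},
      ends = case_sum (ends G) (\<lambda>i. ps ! i)\<rparr>"

text \<open>The quantity \<open>F(G, k)\<close>.\<close>

definition spanning_tree_deficit :: "('v, 'e) multigraph \<Rightarrow> nat \<Rightarrow> enat" where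
  "spanning_tree_deficit G k =
     (INF ps \<in> {ps. (\<forall>p \<in> set ps. p \<subseteq> vertices G \<and> card p = 2) \<and>
                    disjoint_spanning_trees (add_edges G ps) k}. enat (length ps))"


section \<open>Orientations\<close>

text \<open>
  An orientation of a set \<open>S\<close> of edges of \<open>G\<close> is a digraph on the vertices of \<open>G\<close> with arc
  set \<open>S\<close>. The values of \<open>tail\<close> and \<open>head\<close> outside \<open>S\<close> are irrelevant.
\<close>

definition orientation_of ::
  "('v, 'e) multigraph \<Rightarrow> 'e set \<Rightarrow> ('v, 'e) pre_digraph \<Rightarrow> bool" where
  "orientation_of G S D \<longleftrightarrow>
     S \<subseteq> edges G \<and> verts D = vertices G \<and> arcs D = S \<and>
     (\<forall>e \<in> S. {tail D e, head D e} = ends G e)"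

definition extends :: "('v, 'e) pre_digraph \<Rightarrow> ('v, 'e) pre_digraph \<Rightarrow> bool" where
  "extends D D0 \<longleftrightarrow>
     arcs D0 \<subseteq> arcs D \<and> (\<forall>e \<in> arcs D0. tail D e = tail D0 e \<and> head D e = head D0 e)"

text \<open>\<open>3\<close> is the library's type of integers modulo 3.\<close>

definition net_outdegree :: "('v, 'e) pre_digraph \<Rightarrow> 'v \<Rightarrow> 3" where
  "net_outdegree D v = of_nat (out_degree D v) - of_nat (in_degree D v)"

definition zero_sum :: "('v, 'e) multigraph \<Rightarrow> ('v \<Rightarrow> 3) \<Rightarrow> bool" where
  "zero_sum G \<beta> \<longleftrightarrow> (\<Sum>v \<in> vertices G. \<beta> v) = 0"

definition beta_orientation ::
  "('v, 'e) multigraph \<Rightarrow> ('v \<Rightarrow> 3) \<Rightarrow> ('v, 'e) pre_digraph \<Rightarrow> bool" where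
  "beta_orientation G \<beta> D \<longleftrightarrow>
     orientation_of G (edges G) D \<and> (\<forall>v \<in> vertices G. net_outdegree D v = \<beta> v)"

definition Z3_connected :: "('v, 'e) multigraph \<Rightarrow> bool" where
  "Z3_connected G \<longleftrightarrow> (\<forall>\<beta>. zero_sum G \<beta> \<longrightarrow> (\<exists>D. beta_orientation G \<beta> D))"

definition Z3_extendable_at :: "('v, 'e) multigraph \<Rightarrow> 'v \<Rightarrow> bool" where
  "Z3_extendable_at G z \<longleftrightarrow>
     (\<forall>\<beta> D0. zero_sum G \<beta> \<and> orientation_of G (incident_edges G z) D0 \<and>
             net_outdegree D0 z = \<beta> z \<longrightarrow>
        (\<exists>D. beta_orientation G \<beta> D \<and> extends D D0))"


section \<open>Consistency of the conventions\<close>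

lemma adjacency_mem:
  assumes "wf_multigraph G" "(u, v) \<in> adjacency G"
  shows "u \<in> vertices G" "v \<in> vertices G"
  using assms unfolding wf_multigraph_def adjacency_def by auto

lemma sym_adjacency: "sym (adjacency G)"
  unfolding adjacency_def sym_def by (auto simp: insert_commute)

lemma graph_delete_edges: "wf_multigraph G \<Longrightarrow> wf_multigraph (delete_edges G S)"
  unfolding wf_multigraph_def delete_edges_def by auto

lemma connected_graph_iff_components:
  assumes "wf_multigraph G"
  shows "connected_graph G \<longleftrightarrow> card (graph_components G) = 1"
proof
  have eq: "equiv UNIV ((adjacency G)\<^sup>*)"
    by (intro equivI refl_rtrancl trans_rtrancl sym_rtrancl sym_adjacency) auto
  show "card (graph_components G) = 1" if c: "connected_graph G"
  proof -
    obtain x where x: "x \<in> vertices G" using assms by (auto simp: wf_multigraph_def)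
    have "(adjacency G)\<^sup>* `` {u} = (adjacency G)\<^sup>* `` {x}" if "u \<in> vertices G" for u
      using equiv_class_eq[OF eq, of u x] c x that by (auto simp: connected_graph_def)
    then have "graph_components G = {(adjacency G)\<^sup>* `` {x}}"
      using x unfolding graph_components_def quotient_def by blast
    then show ?thesis by simp
  qed
  show "connected_graph G" if c: "card (graph_components G) = 1"
  proof -
    obtain X where X: "graph_components G = {X}" using c by (auto simp: card_1_singleton_iff)
    have m: "(adjacency G)\<^sup>* `` {u} = X" if "u \<in> vertices G" for u
      using X quotientI[OF that, of "(adjacency G)\<^sup>*"] by (simp add: graph_components_def)
    have "(u, v) \<in> (adjacency G)\<^sup>*" if "u \<in> vertices G" "v \<in> vertices G" for u v
    proof -
      have "v \<in> (adjacency G)\<^sup>* `` {v}" by simp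
      then have "v \<in> (adjacency G)\<^sup>* `` {u}" using m that by simp
      then show ?thesis by simp
    qed
    then show ?thesis using assms by (simp add: connected_graph_def wf_multigraph_def)
  qed
qed

lemma card_components_pos:
  assumes "wf_multigraph G" shows "card (graph_components G) \<ge> 1"
proof -
  have "finite (graph_components G)" "graph_components G \<noteq> {}"
    using assms by (auto simp: graph_components_def quotient_def wf_multigraph_def)
  then show ?thesis by (simp add: Suc_le_eq card_gt_0_iff)
qed

lemma edge_connectivity_ge_2_iff:
  assumes "wf_multigraph G"
  shows "edge_connectivity G \<ge> 2 \<longleftrightarrow> connected_graph G \<and> (\<nexists>e. bridge G e)"
proof -
  have fin: "finite (edges G)" using assms by (auto simp: wf_multigraph_def)
  have del0: "delete_edges G {} = G" by (simp add: delete_edges_def)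
  have br: "bridge G e \<longleftrightarrow> e \<in> edges G \<and> \<not> connected_graph (delete_edges G {e})"
    if "connected_graph G" for e
    using that card_components_pos[OF graph_delete_edges[OF assms, of "{e}"]]
    unfolding bridge_def connected_graph_iff_components[OF assms]
      connected_graph_iff_components[OF graph_delete_edges[OF assms]] by auto
  have two: "2 \<le> enat n \<longleftrightarrow> \<not> n \<le> 1" for n :: nat
    by (metis enat_ord_simps(1) not_less_eq_eq numeral_2_eq_2 numeral_eq_enat One_nat_def)
  have "edge_connectivity G \<ge> 2 \<longleftrightarrow>
      (\<forall>S. S \<subseteq> edges G \<and> card S \<le> 1 \<longrightarrow> connected_graph (delete_edges G S))"
    unfolding edge_connectivity_def le_INF_iff using two by auto
  also have "\<dots> \<longleftrightarrow> (\<forall>S. S = {} \<or> (\<exists>e \<in> edges G. S = {e}) \<longrightarrow>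
      connected_graph (delete_edges G S))"
  proof -
    have "S \<subseteq> edges G \<and> card S \<le> 1 \<longleftrightarrow> S = {} \<or> (\<exists>e \<in> edges G. S = {e})" for S
      using fin by (auto simp: le_Suc_eq card_1_singleton_iff dest: finite_subset)
    then show ?thesis by simp
  qed
  also have "\<dots> \<longleftrightarrow> connected_graph G \<and> (\<nexists>e. bridge G e)"
    using br del0 by metis
  finally show ?thesis .
qed

lemma spanning_tree_add_edges_Nil:
  "spanning_tree (add_edges G []) (Inl ` T) \<longleftrightarrow> spanning_tree G T"
proof -
  have sub: "Inl ` T \<subseteq> edges (add_edges G []) \<longleftrightarrow> T \<subseteq> edges G"
    by (auto simp: add_edges_def)
  let ?H = "G\<lparr>edges := T\<rparr>" and ?K = "(add_edges G [])\<lparr>edges := Inl ` T\<rparr>"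
  have "adjacency ?K = adjacency ?H"
    by (auto simp: adjacency_def add_edges_def)
  then have con: "connected_graph ?K = connected_graph ?H"
    by (simp add: connected_graph_def add_edges_def)
  have map: "graph_cycle ?K xs (map Inl es) = graph_cycle ?H xs es" for xs es
    by (auto simp: graph_cycle_def add_edges_def distinct_map image_subset_iff subset_iff)
  have "\<exists>fs. es = map Inl fs" if "set es \<subseteq> Inl ` T" for es :: "('b + nat) list"
    using that by (metis ex_map_conv image_iff subset_iff)
  moreover have "set es \<subseteq> Inl ` T" if "graph_cycle ?K xs es" for xs es
    using that by (simp add: graph_cycle_def)
  ultimately have "(\<exists>xs es. graph_cycle ?K xs es) = (\<exists>xs es. graph_cycle ?H xs es)"
    using map by metis
  with con sub show ?thesis by (simp add: spanning_tree_def tree_def)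
qed

lemma spanning_tree_deficit_eq_0_iff:
  "spanning_tree_deficit G k = 0 \<longleftrightarrow> disjoint_spanning_trees G k"
proof -
  have "spanning_tree_deficit G k = 0 \<longleftrightarrow> disjoint_spanning_trees (add_edges G []) k"
  proof -
    let ?A = "{ps. (\<forall>p \<in> set ps. p \<subseteq> vertices G \<and> card p = 2) \<and>
                    disjoint_spanning_trees (add_edges G ps) k}"
    have "spanning_tree_deficit G k = 0 \<longleftrightarrow> \<not> 1 \<le> spanning_tree_deficit G k"
      by (simp only: not_le one_eSuc iless_eSuc0)
    also have "\<dots> \<longleftrightarrow> (\<exists>ps \<in> ?A. \<not> 1 \<le> enat (length ps))"
      unfolding spanning_tree_deficit_def le_INF_iff by blast
    also have "\<dots> \<longleftrightarrow> [] \<in> ?A"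
      by (auto simp: one_enat_def Suc_le_eq)
    finally show ?thesis by simp
  qed
  also have "\<dots> \<longleftrightarrow> disjoint_spanning_trees G k"
  proof
    assume "disjoint_spanning_trees (add_edges G []) k"
    then obtain T where T: "\<forall>i < k. spanning_tree (add_edges G []) (T i)"
        "\<forall>i < k. \<forall>j < k. i \<noteq> j \<longrightarrow> T i \<inter> T j = {}"
      by (auto simp: disjoint_spanning_trees_def)
    define U where "U i = Inl -` T i" for i
    have "T i = Inl ` U i" if "i < k" for i
    proof -
      have "T i \<subseteq> range Inl"
        using T(1) that unfolding spanning_tree_def add_edges_def by fastforce
      then show ?thesis by (auto simp: U_def)
    qed
    then have "\<forall>i < k. spanning_tree G (U i)"
      using T(1) spanning_tree_add_edges_Nil by metis
    moreover have "\<forall>i < k. \<forall>j < k. i \<noteq> j \<longrightarrow> U i \<inter> U j = {}"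
      using T(2) by (auto simp: U_def)
    ultimately show "disjoint_spanning_trees G k"
      by (auto simp: disjoint_spanning_trees_def)
  next
    assume "disjoint_spanning_trees G k"
    then obtain T where T: "\<forall>i < k. spanning_tree G (T i)"
        "\<forall>i < k. \<forall>j < k. i \<noteq> j \<longrightarrow> T i \<inter> T j = {}"
      by (auto simp: disjoint_spanning_trees_def)
    show "disjoint_spanning_trees (add_edges G []) k"
      unfolding disjoint_spanning_trees_def
      by (rule exI[of _ "\<lambda>i. Inl ` T i"])
        (use T in \<open>auto simp: spanning_tree_add_edges_Nil\<close>)
  qed
  finally show ?thesis .
qed

end

theory Submission
  imports Defs
begin

text \<open>
  Part (ii) follows from part (i) applied to \<open>G - v\<close>: deleting a vertex of degree at most 7 costs at
  most 7 edges in each partition, that is, at most 3 beyond the 4 allowed for the lost class. For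
  part (i) only the partition bound \<open>e(P) \<ge> 4 \<bar>P\<bar> - 7\<close> is used. In a minimal counterexample no proper
  induced subgraph with at least two vertices satisfies the hypotheses, since it could be contracted.
  Refining a partition inside one class then shows that all cuts have at least 6 edges, except at
  vertices of degree 5, which are removed by lifting. The 6-edge-connected case is the theorem of
  Lovasz, Thomassen, Wu and Zhang, proved here by their induction on graphs with one vertex \<open>z\<^sub>0\<close>
  of pre-oriented edges.
\<close>

section \<open>Nowhere zero maps with prescribed boundary\<close>

text \<open>The obstacle is that density passes to contractions but not to induced subgraphs
  \<open>G[A]\<close>. This failure is itself the tool: it supplies a partition of \<open>A\<close>
  into some \<open>k\<close> classes with at most \<open>4k - 7\<close> crossing edges, and at most
  \<open>4k - 8\<close> once all cuts of \<open>G[A]\<close> have 2 edges. Spliced into one class of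
  a partition of \<open>G\<close>, it shows that the coarser partition was not tight, so only the
  partition into single vertices can be. With the complement of \<open>A\<close> as one further
  class, it bounds the cut of \<open>A\<close> from below by 4, 5 and 6 in turn, each bound
  controlling the cuts of \<open>G[A]\<close> for the next one. The 6-edge-connected case needs the
  stronger form with \<open>z\<^sub>0\<close> because a tight set is oriented last, when the edges
  leaving it are already directed. The same number \<open>4 + tau\<close> bounds all cuts from below
  and the degree of \<open>z\<^sub>0\<close> from above, so that the contracted complement of a
  tight set can serve as the new \<open>z\<^sub>0\<close>. As \<open>tau\<close> is at most 2 for
  even and 3 for odd degrees, cuts of at least 6 edges satisfy every prescription.\<close>

lemma z3_cases:
  fixes x :: 3
  obtains "x = 0" | "x = 1" | "x = -1"
proof -
  have "card {0, 1, -1 :: 3} = 3" by simp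
  then have "(UNIV :: 3 set) = {0, 1, -1}"
    by (intro card_subset_eq[symmetric]) auto
  then show thesis using that by auto
qed

definition ref_graph :: "'v set \<Rightarrow> 'e set \<Rightarrow> ('e \<Rightarrow> 'v) \<Rightarrow> ('e \<Rightarrow> 'v) \<Rightarrow> bool" where
  "ref_graph V E a b \<longleftrightarrow> finite V \<and> finite E \<and> (\<forall>e\<in>E. a e \<in> V \<and> b e \<in> V)"

text \<open>
  Edges carry a reference direction from \<open>a e\<close> to \<open>b e\<close>, and an orientation is a nowhere zero
  map \<open>s\<close> into the integers modulo 3: \<open>s e = 1\<close> keeps the direction and \<open>s e = -1\<close> reverses it.
  Loops are allowed here, so that contraction is just composition of \<open>a\<close> and \<open>b\<close> with a map.
\<close>

definition boundary :: "'e set \<Rightarrow> ('e \<Rightarrow> 'v) \<Rightarrow> ('e \<Rightarrow> 'v) \<Rightarrow> ('e \<Rightarrow> 3) \<Rightarrow> 'v \<Rightarrow> 3" where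
  "boundary E a b s v = (\<Sum>e\<in>E. s e * (of_bool (a e = v) - of_bool (b e = v)))"

definition realizable ::
  "'v set \<Rightarrow> 'e set \<Rightarrow> ('e \<Rightarrow> 'v) \<Rightarrow> ('e \<Rightarrow> 'v) \<Rightarrow> ('v \<Rightarrow> 3) \<Rightarrow> bool" where
  "realizable V E a b g \<longleftrightarrow>
     (\<exists>s. (\<forall>e\<in>E. s e \<noteq> 0) \<and> (\<forall>v\<in>V. boundary E a b s v = g v))"

definition cut_deg :: "'e set \<Rightarrow> ('e \<Rightarrow> 'v) \<Rightarrow> ('e \<Rightarrow> 'v) \<Rightarrow> 'v set \<Rightarrow> nat" where
  "cut_deg E a b A = (\<Sum>e\<in>E. of_bool ((a e \<in> A) \<noteq> (b e \<in> A)))"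

text \<open>
  Meaningful only if \<open>x\<close> is an end of \<open>e\<close>.
\<close>

definition far :: "('e \<Rightarrow> 'v) \<Rightarrow> ('e \<Rightarrow> 'v) \<Rightarrow> 'v \<Rightarrow> 'e \<Rightarrow> 'v" where
  "far a b x e = (if a e = x then b e else a e)"

definition induced_edges :: "'e set \<Rightarrow> ('e \<Rightarrow> 'v) \<Rightarrow> ('e \<Rightarrow> 'v) \<Rightarrow> 'v set \<Rightarrow> 'e set" where
  "induced_edges E a b A = {e\<in>E. a e \<in> A \<and> b e \<in> A}"

text \<open>The contracted set is represented by one of its own vertices, so the quotient keeps the
  vertex type and the induction hypothesis applies to it.\<close>

definition collapse :: "'v set \<Rightarrow> 'v \<Rightarrow> 'v \<Rightarrow> 'v" where
  "collapse A p x = (if x \<in> A then p else x)"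

definition push :: "('v \<Rightarrow> 'w) \<Rightarrow> 'v set \<Rightarrow> ('v \<Rightarrow> 'a::comm_monoid_add) \<Rightarrow> 'w \<Rightarrow> 'a" where
  "push f V h y = sum h {x\<in>V. f x = y}"

lemma sum_push:
  assumes "finite V" "B \<subseteq> f ` V"
  shows "sum (push f V h) B = sum h {x\<in>V. f x \<in> B}"
proof -
  have fB: "finite B" using assms finite_subset by blast
  have "sum (push f V h) B = (\<Sum>y\<in>B. sum h {x \<in> {x\<in>V. f x \<in> B}. f x = y})"
    unfolding push_def by (intro sum.cong refl) (auto intro!: arg_cong[of _ _ "sum h"])
  also have "\<dots> = sum h {x\<in>V. f x \<in> B}"
    by (rule sum.group) (use assms fB in auto)
  finally show ?thesis .
qed

lemma sum_of_bool_eq_mem: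
  assumes "finite A"
  shows "(\<Sum>v\<in>A. of_bool (x = v)) = (of_bool (x \<in> A) :: 'a :: semiring_1)"
  using assms by (simp add: of_bool_def)

lemma sum_boundary:
  assumes "finite A"
  shows "(\<Sum>v\<in>A. boundary E a b s v) = (\<Sum>e\<in>E. s e * (of_bool (a e \<in> A) - of_bool (b e \<in> A)))"
  unfolding boundary_def
  by (subst sum.swap)
    (simp only: sum_subtractf sum_of_bool_eq_mem[OF assms] flip: sum_distrib_left)

lemma sum_boundary_closed:
  assumes "finite A" "\<forall>e\<in>E. (a e \<in> A) = (b e \<in> A)"
  shows "(\<Sum>v\<in>A. boundary E a b s v) = 0"
  using assms by (simp add: sum_boundary)

lemma boundary_cong:
  assumes "\<And>e. e \<in> E \<Longrightarrow> s e = s' e"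
  shows "boundary E a b s v = boundary E a b s' v"
  using assms unfolding boundary_def by simp

lemma boundary_union:
  assumes "finite E" "E' \<subseteq> E"
  shows "boundary E a b s v = boundary E' a b s v + boundary (E - E') a b s v"
  using assms unfolding boundary_def by (simp add: sum.subset_diff[of E' E] add.commute)

lemma boundary_single:
  assumes "x \<in> {a e, b e}"
  shows "c * (of_bool (a e = v) - of_bool (b e = v)) =
    (if a e = x then c else - c) * (of_bool (x = v) - of_bool (far a b x e = v) :: 3)"
  using assms by (auto simp: far_def of_bool_def)

lemma boundary_remove:
  assumes "finite E" "e \<in> E"
  shows "boundary E a b s v =
    s e * (of_bool (a e = v) - of_bool (b e = v)) + boundary (E - {e}) a b s v"
  using assms unfolding boundary_def by (simp add: sum.remove)

section \<open>Reductions: deletion, lifting, isolated vertices, contraction\<close>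

lemma realizable_delete:
  assumes "finite E" "e \<in> E" "x \<in> {a e, b e}" "c \<noteq> 0"
    and "realizable V (E - {e}) a b (\<lambda>v. g v - c * (of_bool (x = v) - of_bool (far a b x e = v)))"
  shows "realizable V E a b g"
proof -
  obtain s where s: "\<forall>e\<in>E - {e}. s e \<noteq> 0"
    "\<forall>v\<in>V. boundary (E - {e}) a b s v = g v - c * (of_bool (x = v) - of_bool (far a b x e = v))"
    using assms(5) unfolding realizable_def by blast
  define s' where "s' = s(e := if a e = x then c else - c)"
  have "boundary E a b s' v = g v" if "v \<in> V" for v
  proof -
    have "boundary (E - {e}) a b s' v = boundary (E - {e}) a b s v"
      by (rule boundary_cong) (auto simp: s'_def)
    then show ?thesis
      using s(2) that boundary_single[of x a e b "s' e" v] assms(1-3) boundary_remove[of E e a b s' v]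
      by (cases "a e = x") (simp_all add: s'_def)
  qed
  moreover have "\<forall>e\<in>E. s' e \<noteq> 0" using s(1) assms(4) by (auto simp: s'_def)
  ultimately show ?thesis unfolding realizable_def by blast
qed

text \<open>The label \<open>e1\<close> is reused for the lifted edge, directed from the far end of
  \<open>e2\<close> to that of \<open>e1\<close>. Its value is routed along \<open>e2\<close> to
  \<open>x\<close> and on along \<open>e1\<close>, so the contributions at \<open>x\<close>
  cancel.\<close>

lemma realizable_lift:
  assumes "finite E" "e1 \<in> E" "e2 \<in> E" "e1 \<noteq> e2" "x \<in> {a e1, b e1}" "x \<in> {a e2, b e2}"
    and "realizable V (E - {e2}) (a(e1 := far a b x e2)) (b(e1 := far a b x e1)) g"
  shows "realizable V E a b g"
proof -
  let ?a = "a(e1 := far a b x e2)" and ?b = "b(e1 := far a b x e1)"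
  obtain s where s: "\<forall>e\<in>E - {e2}. s e \<noteq> 0"
    "\<forall>v\<in>V. boundary (E - {e2}) ?a ?b s v = g v"
    using assms(7) unfolding realizable_def by blast
  define s' where "s' = s(e1 := if a e1 = x then s e1 else - s e1, e2 := if a e2 = x then - s e1 else s e1)"
  have n: "\<forall>e\<in>E. s' e \<noteq> 0" using s(1) assms(2,4) by (auto simp: s'_def)
  have "boundary E a b s' v = g v" if "v \<in> V" for v
  proof -
    have eq: "boundary (E - {e2} - {e1}) a b s' v = boundary (E - {e2} - {e1}) ?a ?b s v"
      unfolding boundary_def by (intro sum.cong) (auto simp: s'_def)
    have h1: "s' e1 * (of_bool (a e1 = v) - of_bool (b e1 = v)) =
        s e1 * (of_bool (x = v) - of_bool (far a b x e1 = v))"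
      using boundary_single[of x a e1 b "s' e1" v] assms(4,5)
      by (cases "a e1 = x") (simp_all add: s'_def)
    have h2: "s' e2 * (of_bool (a e2 = v) - of_bool (b e2 = v)) =
        - s e1 * (of_bool (x = v) - of_bool (far a b x e2 = v))"
      using boundary_single[of x a e2 b "s' e2" v] assms(4,6)
      by (cases "a e2 = x") (simp_all add: s'_def)
    have "boundary E a b s' v = s' e2 * (of_bool (a e2 = v) - of_bool (b e2 = v)) +
        (s' e1 * (of_bool (a e1 = v) - of_bool (b e1 = v)) + boundary (E - {e2} - {e1}) a b s' v)"
      using assms(1-4) by (simp only: boundary_remove[of E e2] boundary_remove[of "E - {e2}" e1]
        finite_Diff Diff_iff singleton_iff simp_thms)
    also have "\<dots> = boundary (E - {e2} - {e1}) ?a ?b s v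
      + s e1 * (of_bool (far a b x e2 = v) - of_bool (far a b x e1 = v))"
      unfolding h1 h2 eq by (simp add: algebra_simps)
    also have "\<dots> = boundary (E - {e2}) ?a ?b s v"
      using assms by (subst boundary_remove[of "E - {e2}" e1]) auto
    finally show ?thesis using s(2) that by simp
  qed
  then show ?thesis using n unfolding realizable_def by blast
qed

lemma realizable_remove_vertex:
  assumes "\<forall>e\<in>E. a e \<noteq> x \<and> b e \<noteq> x" "g x = 0" "realizable (V - {x}) E a b g"
  shows "realizable V E a b g"
proof -
  obtain s where s: "\<forall>e\<in>E. s e \<noteq> 0" "\<forall>v\<in>V - {x}. boundary E a b s v = g v"
    using assms(3) unfolding realizable_def by blast
  have "boundary E a b s x = g x"
    unfolding boundary_def using assms(1,2) by (auto intro!: sum.neutral)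
  then show ?thesis using s unfolding realizable_def by (metis DiffI singletonD)
qed

text \<open>The edges inside \<open>A\<close> become loops, so their values do not affect the
  contracted solution and can be replaced. That solution is correct at each vertex outside
  \<open>A\<close> and in total on \<open>A\<close>; hence the demand left to the inner edges sums
  to zero, as \<open>ind\<close> requires.\<close>

lemma realizable_contract:
  fixes g :: "'v \<Rightarrow> 3"
  assumes G: "ref_graph V E a b" and A: "A \<subseteq> V" "p \<in> A"
    and con: "realizable (collapse A p ` V) E (collapse A p \<circ> a) (collapse A p \<circ> b)
      (push (collapse A p) V g)"
    and ind: "\<And>s. \<forall>e\<in>E. s e \<noteq> 0 \<Longrightarrow>
      (\<Sum>x\<in>A. g x - boundary (E - induced_edges E a b A) a b s x) = 0 \<Longrightarrow>
      realizable A (induced_edges E a b A) a b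
        (\<lambda>x. g x - boundary (E - induced_edges E a b A) a b s x)"
  shows "realizable V E a b g"
proof -
  let ?f = "collapse A p" and ?I = "induced_edges E a b A"
  have fin: "finite V" "finite E" "finite A"
    using G A finite_subset by (auto simp: ref_graph_def)
  have IE: "?I \<subseteq> E" by (auto simp: induced_edges_def)
  obtain s where s: "\<forall>e\<in>E. s e \<noteq> 0"
    "\<forall>y\<in>?f ` V. boundary E (?f \<circ> a) (?f \<circ> b) s y = push ?f V g y"
    using con unfolding realizable_def by blast
  have I0: "boundary ?I a b s' v = 0" if "v \<notin> A" for v s'
    unfolding boundary_def by (rule sum.neutral) (use that in \<open>auto simp: induced_edges_def\<close>)
  have out: "boundary (E - ?I) a b s v = g v" if v: "v \<in> V" "v \<notin> A" for v
  proof -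
    have vp: "v \<noteq> p" "?f v = v" using v A by (auto simp: collapse_def)
    have "boundary (E - ?I) a b s v = boundary E a b s v"
      using boundary_union[OF fin(2) IE, of a b s v] I0[OF v(2)] by simp
    also have "\<dots> = boundary E (?f \<circ> a) (?f \<circ> b) s v"
      unfolding boundary_def using v vp by (auto simp: collapse_def intro!: sum.cong)
    also have "\<dots> = push ?f V g v" using s(2) v vp by force
    also have "{x\<in>V. ?f x = v} = {v}" using v vp by (auto simp: collapse_def split: if_splits)
    then have "push ?f V g v = g v" by (simp add: push_def)
    finally show ?thesis .
  qed
  have "(\<Sum>x\<in>A. boundary (E - ?I) a b s x) = (\<Sum>x\<in>A. boundary E a b s x)"
    using boundary_union[OF fin(2) IE, of a b s] sum_boundary_closed[of A ?I a b s] fin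
    by (simp add: sum.distrib induced_edges_def)
  also have "\<dots> = boundary E (?f \<circ> a) (?f \<circ> b) s p"
  proof -
    have "?f x = p \<longleftrightarrow> x \<in> A" for x using A by (auto simp: collapse_def)
    then show ?thesis by (simp add: sum_boundary[OF fin(3)] boundary_def[of _ _ _ _ p])
  qed
  also have "\<dots> = push ?f V g p"
  proof -
    have "p \<in> ?f ` V" using A by (auto simp: collapse_def image_iff intro!: bexI[of _ p])
    then show ?thesis using s(2) by blast
  qed
  also have "{x\<in>V. ?f x = p} = A" using A by (auto simp: collapse_def split: if_splits)
  then have "push ?f V g p = sum g A" by (simp add: push_def)
  finally have "(\<Sum>x\<in>A. g x - boundary (E - ?I) a b s x) = 0" by (simp add: sum_subtractf)
  from ind[OF s(1) this] obtain t where t: "\<forall>e\<in>?I. t e \<noteq> 0"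
    "\<forall>v\<in>A. boundary ?I a b t v = g v - boundary (E - ?I) a b s v"
    unfolding realizable_def by blast
  define r where "r e = (if e \<in> ?I then t e else s e)" for e
  have r: "boundary E a b r v = boundary ?I a b t v + boundary (E - ?I) a b s v" for v
    by (subst boundary_union[OF fin(2) IE], intro arg_cong2[of _ _ _ _ "(+)"] boundary_cong)
       (auto simp: r_def)
  have "boundary E a b r v = g v" if "v \<in> V" for v
    using t(2) out[OF that] I0[of v t] by (cases "v \<in> A") (auto simp: r)
  moreover have "\<forall>e\<in>E. r e \<noteq> 0" using s(1) t(1) by (auto simp: r_def)
  ultimately show ?thesis unfolding realizable_def by blast
qed

text \<open>Two nonzero values can have any sum modulo 3, so the pair corrects whatever the other
  edges, all of value 1, leave at \<open>x\<close>. The equation at \<open>y\<close> follows because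
  the boundary and the demand both sum to zero.\<close>

lemma realizable_parallel_pair:
  assumes fin: "finite E" and E: "\<forall>e\<in>E. a e \<in> {x, y} \<and> b e \<in> {x, y}" and xy: "x \<noteq> y"
    and e: "e1 \<in> E" "e2 \<in> E" "e1 \<noteq> e2" "{a e1, b e1} = {x, y}" "{a e2, b e2} = {x, y}"
    and g: "g x + g y = 0"
  shows "realizable {x, y} E a b g"
proof -
  define r where "r = g x - boundary (E - {e1} - {e2}) a b (\<lambda>_. 1) x"
  obtain c1 c2 :: 3 where c: "c1 \<noteq> 0" "c2 \<noteq> 0" "c1 + c2 = r"
  proof (cases r rule: z3_cases)
    case 1 then show ?thesis using that[of 1 "-1"] by simp
  next
    case 2 then show ?thesis using that[of "-1" "-1"] by simp
  next
    case 3 then show ?thesis using that[of 1 1] by simp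
  qed
  let ?h = "\<lambda>v. g v - c1 * (of_bool (x = v) - of_bool (y = v)) - c2 * (of_bool (x = v) - of_bool (y = v))"
  have far: "far a b x e1 = y" "far a b x e2 = y" "x \<in> {a e1, b e1}" "x \<in> {a e2, b e2}"
    using e xy by (auto simp: far_def doubleton_eq_iff)
  have "boundary (E - {e1} - {e2}) a b (\<lambda>_. 1) x = ?h x"
    using c(3) xy by (simp add: r_def algebra_simps)
  moreover have "boundary (E - {e1} - {e2}) a b (\<lambda>_. 1) y = - boundary (E - {e1} - {e2}) a b (\<lambda>_. 1) x"
  proof -
    have "(\<Sum>v\<in>{x, y}. boundary (E - {e1} - {e2}) a b (\<lambda>_. 1) v) = 0"
      by (rule sum_boundary_closed) (use E in auto)
    then show ?thesis using xy by (simp add: eq_neg_iff_add_eq_0 add.commute)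
  qed
  moreover have "?h y = - ?h x" using g xy by (simp add: algebra_simps eq_neg_iff_add_eq_0)
  ultimately have "\<forall>v\<in>{x, y}. boundary (E - {e1} - {e2}) a b (\<lambda>_. 1) v = ?h v" by simp
  then have "realizable {x, y} (E - {e1} - {e2}) a b ?h"
    unfolding realizable_def by (intro exI[of _ "\<lambda>_. 1"] conjI) (simp, assumption)
  then have "realizable {x, y} (E - {e1}) a b (\<lambda>v. g v - c1 * (of_bool (x = v) - of_bool (y = v)))"
    using fin e(1-3) far c by (intro realizable_delete[of "E - {e1}" e2 x a b c2]) simp_all
  then show ?thesis
    using fin e(1-3) far c by (intro realizable_delete[of E e1 x a b c1]) simp_all
qed

lemma card_collapse:
  assumes "finite V" "A \<subseteq> V" "p \<in> A" "2 \<le> card A"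
  shows "card (collapse A p ` V) < card V"
proof -
  have fA: "finite A" using assms finite_subset by blast
  have "collapse A p ` V \<subseteq> insert p (V - A)" by (auto simp: collapse_def)
  then have "card (collapse A p ` V) \<le> card (insert p (V - A))"
    using assms by (intro card_mono) auto
  also have "\<dots> = Suc (card V - card A)"
    using assms fA by (simp add: card_Diff_subset)
  also have "\<dots> < card V" using assms card_mono[OF assms(1,2)] by simp
  finally show ?thesis .
qed

lemma realizable_contract_parallel:
  assumes G: "ref_graph V E a b" and e: "e1 \<in> E" "e2 \<in> E" "e1 \<noteq> e2"
    and xy: "x \<noteq> y" "{a e1, b e1} = {x, y}" "{a e2, b e2} = {x, y}"
    and con: "realizable (collapse {x, y} x ` V) E (collapse {x, y} x \<circ> a) (collapse {x, y} x \<circ> b)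
      (push (collapse {x, y} x) V g)"
  shows "realizable V E a b g"
proof (rule realizable_contract[OF G _ _ con])
  have "a e1 \<in> V" "b e1 \<in> V" "finite E" using G e by (auto simp: ref_graph_def)
  then show "{x, y} \<subseteq> V" unfolding xy(2)[symmetric] by simp
  fix s
  assume "(\<Sum>v\<in>{x, y}. g v - boundary (E - induced_edges E a b {x, y}) a b s v) = 0"
  then show "realizable {x, y} (induced_edges E a b {x, y}) a b
      (\<lambda>v. g v - boundary (E - induced_edges E a b {x, y}) a b s v)"
    using xy e \<open>finite E\<close>
    by (intro realizable_parallel_pair[where ?e1.0 = e1 and ?e2.0 = e2]) (auto simp: induced_edges_def)
qed simp

locale loopless =
  fixes V :: "'v set" and E :: "'e set" and a b :: "'e \<Rightarrow> 'v"
  assumes graph: "ref_graph V E a b" and no_loop: "e \<in> E \<Longrightarrow> a e \<noteq> b e"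
begin

lemma finV: "finite V" and finE: "finite E"
  and ends_in: "e \<in> E \<Longrightarrow> a e \<in> V" "e \<in> E \<Longrightarrow> b e \<in> V"
  using graph by (auto simp: ref_graph_def)

definition star :: "'v \<Rightarrow> 'e set" where
  "star x = {e\<in>E. x \<in> {a e, b e}}"

lemma star_E: "star x \<subseteq> E" by (auto simp: star_def)

lemma card_star: "cut_deg E a b {x} = card (star x)"
proof -
  have "card (star x) = (\<Sum>e\<in>E. of_bool (e \<in> star x))"
    using star_E finE by (simp add: Int_absorb1 of_bool_def sum.If_cases)
  also have "\<dots> = cut_deg E a b {x}"
    unfolding cut_deg_def by (intro sum.cong) (auto simp: star_def dest: no_loop)
  finally show ?thesis by simp
qed

lemma star_far:
  assumes "e \<in> star x"
  shows "e \<in> E" "x \<in> {a e, b e}" "far a b x e \<in> V" "far a b x e \<noteq> x" "x \<in> V"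
    and "{a e, b e} = {x, far a b x e}"
  using assms no_loop[of e] ends_in by (auto simp: star_def far_def)

text \<open>Edges from \<open>x\<close> into \<open>A\<close> leave the cut and the remaining edges
  at \<open>x\<close> join it.\<close>

lemma cut_deg_insert:
  assumes "x \<notin> A"
  shows "cut_deg E a b (insert x A) + 2 * card {e\<in>star x. far a b x e \<in> A} =
    cut_deg E a b A + card (star x)"
proof -
  have card: "card S = (\<Sum>e\<in>E. of_bool (e \<in> S))" if "S \<subseteq> E" for S
    using that finE by (simp add: Int_absorb1 of_bool_def sum.If_cases)
  have S: "star x \<subseteq> E" "{e\<in>star x. far a b x e \<in> A} \<subseteq> E" by (auto simp: star_def)
  show ?thesis
    unfolding cut_deg_def card[OF S(1)] card[OF S(2)] sum_distrib_left sum.distrib[symmetric]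
  proof (intro sum.cong refl)
    fix e assume "e \<in> E"
    then have "a e \<noteq> b e" by (rule no_loop)
    then show "of_bool ((a e \<in> insert x A) \<noteq> (b e \<in> insert x A))
        + 2 * of_bool (e \<in> {e\<in>star x. far a b x e \<in> A}) =
      of_bool ((a e \<in> A) \<noteq> (b e \<in> A)) + (of_bool (e \<in> star x) :: nat)"
      using assms \<open>e \<in> E\<close> by (auto simp: star_def far_def)
  qed
qed

end

section \<open>Partial flow extension\<close>

text \<open>
  The absolute value of the invariant of Lovasz, Thomassen, Wu and Zhang: \<open>tau n c\<close> is the least
  \<open>\<bar>t\<bar>\<close> among the integers \<open>t\<close> that are congruent to \<open>n\<close> modulo 2 and to \<open>c\<close> modulo 3.
\<close>

definition tau :: "nat \<Rightarrow> 3 \<Rightarrow> nat" where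
  "tau n c = (if c = 0 then (if even n then 0 else 3) else (if even n then 2 else 1))"

lemma even_tau: "even (tau n c) \<longleftrightarrow> even n"
  by (simp add: tau_def)

lemma tau_le_3: "tau n c \<le> 3"
  by (simp add: tau_def)

lemma tau_cong_parity: "even n = even n' \<Longrightarrow> tau n c = tau n' c"
  by (simp add: tau_def)

text \<open>The alternatives are the effects of a reduction on a set with at least two vertices.
  Losing one edge must change the value: from \<open>n = 6\<close> and \<open>c = 0\<close> one
  would otherwise reach degree 5 with value 0, where \<open>tau\<close> is 3.\<close>

lemma tau_slack:
  assumes "6 + tau n c \<le> n"
    and "n' = n \<or> n' + 2 = n \<and> c' = c \<or> n' + 1 = n \<and> c' \<noteq> c \<or> n' = n + 1"
  shows "4 + tau n' c' \<le> n'"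
  using assms by (cases "even n") (auto simp: tau_def split: if_splits)

text \<open>Distinct values modulo 3 differ by 1 or -1, so an integer \<open>t\<close> of least
  absolute value for \<open>n\<close> and \<open>c\<close> turns into \<open>t + 1\<close> or
  \<open>t - 1\<close>, which is admissible for \<open>Suc n\<close> and \<open>c'\<close>.\<close>

lemma tau_Suc_le: "c' \<noteq> c \<Longrightarrow> tau (Suc n) c' \<le> tau n c + 1"
  by (auto simp: tau_def)

text \<open>The number of edges leaving \<open>A\<close> when \<open>z\<^sub>0\<close> is restored
  with \<open>m x\<close> edges to each vertex \<open>x\<close>.\<close>

definition tdeg :: "'e set \<Rightarrow> ('e \<Rightarrow> 'v) \<Rightarrow> ('e \<Rightarrow> 'v) \<Rightarrow> ('v \<Rightarrow> nat) \<Rightarrow> 'v set \<Rightarrow> nat" where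
  "tdeg E a b m A = cut_deg E a b A + sum m A"

text \<open>
  The vertex \<open>z\<^sub>0\<close> with pre-oriented edges is eliminated: \<open>m x\<close> is the number of its edges at
  \<open>x\<close>, \<open>\<beta> x\<close> is the prescribed value at \<open>x\<close> in the whole graph, and \<open>g x\<close> is what remains to be
  realized by the other edges. The pre-orientation is not recorded, only the condition on \<open>\<beta> - g\<close>
  that makes one exist: two or more edges can contribute any value, a single one only 1 or -1.
\<close>

definition config :: "'v set \<Rightarrow> 'e set \<Rightarrow> ('e \<Rightarrow> 'v) \<Rightarrow> ('e \<Rightarrow> 'v) \<Rightarrow>
    ('v \<Rightarrow> 3) \<Rightarrow> ('v \<Rightarrow> nat) \<Rightarrow> ('v \<Rightarrow> 3) \<Rightarrow> bool" where
  "config V E a b g m \<beta> \<longleftrightarrow>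
     ref_graph V E a b \<and> V \<noteq> {} \<and> sum g V = 0 \<and>
     (\<forall>x\<in>V. (m x = 0 \<longrightarrow> \<beta> x = g x) \<and> (m x = 1 \<longrightarrow> \<beta> x \<noteq> g x)) \<and>
     sum m V \<le> 4 + tau (sum m V) (sum \<beta> V) \<and>
     (\<forall>A. A \<noteq> {} \<longrightarrow> A \<subset> V \<longrightarrow> 4 + tau (tdeg E a b m A) (sum \<beta> A) \<le> tdeg E a b m A)"

lemma configI:
  assumes "ref_graph V E a b" "V \<noteq> {}" "sum g V = 0"
    and "\<And>x. x \<in> V \<Longrightarrow> m x = 0 \<Longrightarrow> \<beta> x = g x"
    and "\<And>x. x \<in> V \<Longrightarrow> m x = 1 \<Longrightarrow> \<beta> x \<noteq> g x"
    and "sum m V \<le> 4 + tau (sum m V) (sum \<beta> V)"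
    and "\<And>A. A \<noteq> {} \<Longrightarrow> A \<subset> V \<Longrightarrow> 4 + tau (tdeg E a b m A) (sum \<beta> A) \<le> tdeg E a b m A"
  shows "config V E a b g m \<beta>"
  using assms unfolding config_def by blast

section \<open>Degrees and configurations under deletion, lifting and contraction\<close>

lemma cut_deg_remove:
  assumes "finite E" "e \<in> E"
  shows "cut_deg E a b A = cut_deg (E - {e}) a b A + of_bool ((a e \<in> A) \<noteq> (b e \<in> A))"
  using sum.remove[OF assms, of "\<lambda>e. of_bool ((a e \<in> A) \<noteq> (b e \<in> A)) :: nat"]
  unfolding cut_deg_def by (simp only: add.commute)

lemma crossing_far:
  assumes "x \<in> {a e, b e}"
  shows "((a e \<in> A) \<noteq> (b e \<in> A)) = ((x \<in> A) \<noteq> (far a b x e \<in> A))"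
  using assms by (auto simp: far_def)

lemma cut_deg_delete:
  assumes "finite E" "e \<in> E" "x \<in> {a e, b e}"
  shows "cut_deg E a b A = cut_deg (E - {e}) a b A + of_bool ((x \<in> A) \<noteq> (far a b x e \<in> A))"
  using cut_deg_remove[OF assms(1,2), of a b A] crossing_far[where a=a and b=b and e=e, OF assms(3)] by simp

text \<open>Thus a cut loses 2 edges if it separates \<open>x\<close> from both far ends, and none
  otherwise.\<close>

lemma cut_deg_lift:
  assumes "finite E" "e1 \<in> E" "e2 \<in> E" "e1 \<noteq> e2" "x \<in> {a e1, b e1}" "x \<in> {a e2, b e2}"
  shows "cut_deg (E - {e2}) (a(e1 := far a b x e2)) (b(e1 := far a b x e1)) A
      + of_bool ((x \<in> A) \<noteq> (far a b x e1 \<in> A)) + of_bool ((x \<in> A) \<noteq> (far a b x e2 \<in> A))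
    = cut_deg E a b A + of_bool ((far a b x e1 \<in> A) \<noteq> (far a b x e2 \<in> A))"
proof -
  let ?a = "a(e1 := far a b x e2)" and ?b = "b(e1 := far a b x e1)"
  have eq: "cut_deg (E - {e2} - {e1}) ?a ?b A = cut_deg (E - {e2} - {e1}) a b A"
    unfolding cut_deg_def by (intro sum.cong) auto
  have "cut_deg E a b A = cut_deg (E - {e2} - {e1}) a b A
      + of_bool ((x \<in> A) \<noteq> (far a b x e1 \<in> A)) + of_bool ((x \<in> A) \<noteq> (far a b x e2 \<in> A))"
    using cut_deg_delete[of E e2 x a b A] cut_deg_delete[of "E - {e2}" e1 x a b A] assms by simp
  moreover have "cut_deg (E - {e2}) ?a ?b A = cut_deg (E - {e2} - {e1}) a b A
      + of_bool ((far a b x e1 \<in> A) \<noteq> (far a b x e2 \<in> A))"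
    using cut_deg_remove[of "E - {e2}" e1 ?a ?b A] assms(1,2,4) unfolding eq by auto
  ultimately show ?thesis by simp
qed

lemma cut_deg_compl:
  assumes "ref_graph V E a b" "A \<subseteq> V"
  shows "cut_deg E a b (V - A) = cut_deg E a b A"
  unfolding cut_deg_def
  by (intro sum.cong arg_cong[of _ _ of_bool]) (use assms in \<open>auto simp: ref_graph_def\<close>)

lemma cut_deg_push:
  assumes "ref_graph V E a b"
  shows "cut_deg E (f \<circ> a) (f \<circ> b) B = cut_deg E a b {x\<in>V. f x \<in> B}"
  unfolding cut_deg_def
  by (intro sum.cong arg_cong[of _ _ of_bool]) (use assms in \<open>auto simp: ref_graph_def\<close>)

lemma sum_transfer:
  fixes c :: "'a :: comm_ring_1"
  assumes "finite A"
  shows "(\<Sum>v\<in>A. g v - c * (of_bool (x = v) - of_bool (w = v))) =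
    sum g A - c * (of_bool (x \<in> A) - of_bool (w \<in> A))"
  by (simp only: sum_subtractf sum_of_bool_eq_mem[OF assms] flip: sum_distrib_left)

lemma sum_upd_diff:
  assumes "finite A"
  shows "sum (h(x := c :: 'a :: ab_group_add)) A = sum h A + (if x \<in> A then c - h x else 0)"
proof (cases "x \<in> A")
  case True
  have "sum (h(x := c)) (A - {x}) = sum h (A - {x})" by (intro sum.cong) auto
  then show ?thesis using True assms by (simp add: sum.remove[of A x])
next
  case False
  then have "sum (h(x := c)) A = sum h A" by (intro sum.cong) auto
  then show ?thesis using False by simp
qed

lemma sum_upd_Suc:
  assumes "finite A"
  shows "sum (h(x := Suc (h x))) A = sum h A + of_bool (x \<in> A)"
proof (cases "x \<in> A")
  case True
  have "sum (h(x := Suc (h x))) (A - {x}) = sum h (A - {x})" by (intro sum.cong) auto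
  then show ?thesis using True assms by (simp add: sum.remove[of A x])
next
  case False
  then have "sum (h(x := Suc (h x))) A = sum h A" by (intro sum.cong) auto
  then show ?thesis using False by simp
qed

lemma sum_upd_pred:
  assumes "finite A" "h x = Suc k"
  shows "sum (h(x := k)) A + of_bool (x \<in> A) = sum h A"
proof -
  have "(h(x := k))(x := Suc ((h(x := k)) x)) = h" using assms by auto
  then show ?thesis using sum_upd_Suc[OF assms(1), of "h(x := k)" x] by simp
qed

lemma sum_nat_eq_1:
  assumes "finite S" "sum h S = (1 :: nat)"
  shows "\<exists>x\<in>S. h x = 1 \<and> (\<forall>z\<in>S. z \<noteq> x \<longrightarrow> h z = 0)"
  using assms sum_eq_1_iff[of S h] by metis

text \<open>Cuts of the quotient are cuts of the graph. A fibre of weight 1 has exactly one vertex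
  of weight 1 and otherwise weight 0, so \<beta> and \<open>g\<close> differ at exactly one of its
  vertices and their totals differ too.\<close>

lemma config_push:
  assumes c: "config V E a b g m \<beta>"
  shows "config (f ` V) E (f \<circ> a) (f \<circ> b) (push f V g) (push f V m) (push f V \<beta>)"
proof -
  have G: "ref_graph V E a b" and fin: "finite V" using c by (auto simp: config_def ref_graph_def)
  have all: "{x\<in>V. f x \<in> f ` V} = V" by auto
  note sp = sum_push[OF fin, of _ f]
  show ?thesis
  proof (rule configI)
    show "ref_graph (f ` V) E (f \<circ> a) (f \<circ> b)" using G by (auto simp: ref_graph_def)
    show "f ` V \<noteq> {}" using c by (auto simp: config_def)
    show "sum (push f V g) (f ` V) = 0" using c by (simp add: sp all config_def)
    show "sum (push f V m) (f ` V) \<le> 4 + tau (sum (push f V m) (f ` V)) (sum (push f V \<beta>) (f ` V))"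
      using c by (simp add: sp all config_def)
  next
    fix A assume A: "A \<noteq> {}" "A \<subset> f ` V"
    let ?A = "{x\<in>V. f x \<in> A}"
    have "?A \<noteq> {}" "?A \<subset> V" using A by auto
    then have "4 + tau (tdeg E a b m ?A) (sum \<beta> ?A) \<le> tdeg E a b m ?A"
      using c by (auto simp: config_def)
    then show "4 + tau (tdeg E (f \<circ> a) (f \<circ> b) (push f V m) A) (sum (push f V \<beta>) A)
        \<le> tdeg E (f \<circ> a) (f \<circ> b) (push f V m) A"
      using A by (simp add: tdeg_def sp cut_deg_push[OF G])
  next
    fix y assume y: "y \<in> f ` V"
    let ?F = "{x\<in>V. f x = y}"
    show "push f V \<beta> y = push f V g y" if "push f V m y = 0"
      using that fin c by (auto simp: push_def config_def intro!: sum.cong)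
    show "push f V \<beta> y \<noteq> push f V g y" if "push f V m y = 1"
    proof -
      have "\<exists>x\<in>?F. m x = 1 \<and> (\<forall>z\<in>?F. z \<noteq> x \<longrightarrow> m z = 0)"
        using sum_nat_eq_1[of ?F m] that fin by (auto simp: push_def)
      then obtain x where x: "x \<in> ?F" "m x = 1" "\<forall>z\<in>?F. z \<noteq> x \<longrightarrow> m z = 0" by blast
      have "sum \<beta> (?F - {x}) = sum g (?F - {x})"
        using x c by (intro sum.cong) (auto simp: config_def)
      moreover have "\<beta> x \<noteq> g x" using x c by (auto simp: config_def)
      ultimately show ?thesis using x(1) fin by (simp add: push_def sum.remove[of ?F x])
    qed
  qed
qed

text \<open>The complement of \<open>A\<close> is merged with \<open>z\<^sub>0\<close>, and the
  edges leaving \<open>A\<close>, oriented by \<open>s\<close>, become edges at the new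
  \<open>z\<^sub>0\<close>. An edge outside \<open>I\<close> has at most one end in
  \<open>A\<close>, so \<open>m'\<close> restores exactly the edges that cuts inside
  \<open>A\<close> lose. The assumption \<open>tight\<close> becomes the bound on the degree of the
  new \<open>z\<^sub>0\<close>.\<close>

lemma config_inside:
  assumes c: "config V E a b g m \<beta>" and A: "A \<noteq> {}" "A \<subset> V"
    and tight: "tdeg E a b m A \<le> 4 + tau (tdeg E a b m A) (sum \<beta> A)"
    and s: "\<forall>e\<in>E. s e \<noteq> 0"
    and I: "I = induced_edges E a b A"
    and g': "\<And>x. g' x = g x - boundary (E - I) a b s x" "sum g' A = 0"
    and m': "\<And>x. m' x = m x + (\<Sum>e\<in>E - I. of_bool (a e = x) + of_bool (b e = x))"
  shows "config A I a b g' m' \<beta>"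
proof -
  have fin: "finite V" "finite E" "finite A" and G: "ref_graph V E a b"
    using c A finite_subset by (auto simp: config_def ref_graph_def)
  have IE: "I \<subseteq> E" by (auto simp: I induced_edges_def)
  have td: "tdeg I a b m' B = tdeg E a b m B" if B: "B \<subseteq> A" for B
  proof -
    have fB: "finite B" using B fin finite_subset by blast
    have "sum m' B = sum m B + (\<Sum>e\<in>E - I. of_bool (a e \<in> B) + of_bool (b e \<in> B))"
      unfolding m' sum.distrib by (subst sum.swap, subst sum.swap[of _ "E - I"])
        (simp only: sum_of_bool_eq_mem[OF fB])
    moreover have "(\<Sum>e\<in>E - I. of_bool (a e \<in> B) + of_bool (b e \<in> B)) =
        (\<Sum>e\<in>E - I. of_bool ((a e \<in> B) \<noteq> (b e \<in> B)) :: nat)"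
      using B by (intro sum.cong) (auto simp: I induced_edges_def)
    moreover have "cut_deg E a b B = (\<Sum>e\<in>E - I. of_bool ((a e \<in> B) \<noteq> (b e \<in> B))) + cut_deg I a b B"
      unfolding cut_deg_def using IE fin by (simp only: sum.subset_diff[of I E])
    ultimately show ?thesis by (simp add: tdeg_def)
  qed
  have "cut_deg I a b A = 0" by (auto simp: cut_deg_def I induced_edges_def)
  then have mA: "sum m' A = tdeg E a b m A" using td[of A] by (simp add: tdeg_def)
  show ?thesis
  proof (rule configI)
    show "ref_graph A I a b" using fin IE by (auto simp: ref_graph_def I induced_edges_def intro: finite_subset)
    show "A \<noteq> {}" "sum g' A = 0" by fact+
    show "sum m' A \<le> 4 + tau (sum m' A) (sum \<beta> A)" using tight by (simp add: mA)
    show "4 + tau (tdeg I a b m' B) (sum \<beta> B) \<le> tdeg I a b m' B" if "B \<noteq> {}" "B \<subset> A" for B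
    proof -
      have "B \<subset> V" "B \<subseteq> A" using that A by auto
      then show ?thesis using c that td[of B] by (auto simp: config_def)
    qed
  next
    fix x assume x: "x \<in> A"
    then have xV: "x \<in> V" using A by auto
    let ?k = "\<lambda>e. of_bool (a e = x) + of_bool (b e = x) :: nat"
    have z: "boundary (E - I) a b s x = 0" if "sum ?k (E - I) = 0"
      using that fin unfolding boundary_def by (intro sum.neutral) auto
    show "\<beta> x = g' x" if "m' x = 0"
      using that z c xV by (auto simp: m' g' config_def)
    show "\<beta> x \<noteq> g' x" if "m' x = 1"
    proof (cases "m x = 1")
      case True
      then show ?thesis using that z c xV by (auto simp: m' g' config_def)
    next
      case False
      then have m0: "m x = 0" "sum ?k (E - I) = 1" using that by (auto simp: m')
      then have "\<exists>e\<in>E - I. ?k e = 1 \<and> (\<forall>e'\<in>E - I. e' \<noteq> e \<longrightarrow> ?k e' = 0)"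
        using fin by (intro sum_nat_eq_1) auto
      then obtain e where e: "e \<in> E - I" "?k e = 1" "\<forall>e'\<in>E - I. e' \<noteq> e \<longrightarrow> ?k e' = 0" by blast
      have "boundary (E - I - {e}) a b s x = 0"
        unfolding boundary_def by (rule sum.neutral) (use e(3) in auto)
      then have "boundary (E - I) a b s x = s e * (of_bool (a e = x) - of_bool (b e = x))"
        using boundary_remove[of "E - I" e a b s x] e(1) fin by simp
      also have "\<dots> \<noteq> 0" using e(1,2) s by (auto simp: of_bool_def split: if_splits)
      finally show ?thesis using m0 c xV by (auto simp: g' config_def)
    qed
  qed
qed

section \<open>A minimal counterexample to partial flow extension\<close>

locale critical =
  fixes V :: "'v set" and E :: "'e set" and a b :: "'e \<Rightarrow> 'v" and g :: "'v \<Rightarrow> 3"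
  assumes not_realizable: "\<not> realizable V E a b g"
    and smaller: "\<And>(V' :: 'v set) (E' :: 'e set) a' b' g' m' \<beta>'. config V' E' a' b' g' m' \<beta>' \<Longrightarrow>
      card V' < card V \<or> card V' = card V \<and> card E' < card E \<Longrightarrow> realizable V' E' a' b' g'"

text \<open>Realizability and minimality depend on \<open>V\<close>, \<open>E\<close> and
  \<open>g\<close> only. Keeping \<open>m\<close> and \<beta> apart allows different choices of them
  to be compared on the same counterexample.\<close>

locale critical_config = critical +
  fixes m :: "'a \<Rightarrow> nat" and \<beta> :: "'a \<Rightarrow> 3"
  assumes config: "config V E a b g m \<beta>"
begin

abbreviation d :: "'a set \<Rightarrow> nat" where "d \<equiv> tdeg E a b m"

lemma ref_graph: "ref_graph V E a b"
  and finV: "finite V" and finE: "finite E" and V_ne: "V \<noteq> {}" and sum_g: "sum g V = 0"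
  and ends_in: "e \<in> E \<Longrightarrow> a e \<in> V" "e \<in> E \<Longrightarrow> b e \<in> V"
  and compat: "x \<in> V \<Longrightarrow> m x = 0 \<Longrightarrow> \<beta> x = g x" "x \<in> V \<Longrightarrow> m x = 1 \<Longrightarrow> \<beta> x \<noteq> g x"
  and total: "sum m V \<le> 4 + tau (sum m V) (sum \<beta> V)"
  and deg_ge: "A \<noteq> {} \<Longrightarrow> A \<subset> V \<Longrightarrow> 4 + tau (d A) (sum \<beta> A) \<le> d A"
  using config by (auto simp: config_def ref_graph_def)

text \<open>
  A tight set is contracted first; the orientation found then pre-orients its boundary, which
  leaves a smaller configuration on the set itself.
\<close>

lemma not_tight:
  assumes A: "A \<subset> V" "2 \<le> card A"
  shows "6 + tau (d A) (sum \<beta> A) \<le> d A"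
proof (rule ccontr)
  assume n: "\<not> 6 + tau (d A) (sum \<beta> A) \<le> d A"
  have A0: "A \<noteq> {}" using A by auto
  have fA: "finite A" using A finV finite_subset by blast
  \<comment> \<open>Both sides have the same parity, so a gap of less than 2 is no gap.\<close>
  have tight: "d A = 4 + tau (d A) (sum \<beta> A)"
    using n deg_ge[OF A0 A(1)] even_tau[of "d A" "sum \<beta> A"] by (auto elim!: evenE oddE) presburger+
  obtain p where p: "p \<in> A" using A0 by blast
  have "realizable V E a b g"
  proof (rule realizable_contract[OF ref_graph _ p])
    have "card (collapse A p ` V) < card V"
      using finV A p by (intro card_collapse) auto
    then show "realizable (collapse A p ` V) E (collapse A p \<circ> a) (collapse A p \<circ> b)
        (push (collapse A p) V g)"
      by (intro smaller[OF config_push[OF config]]) simp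
  next
    fix s assume "\<forall>e\<in>E. s e \<noteq> 0"
      "(\<Sum>x\<in>A. g x - boundary (E - induced_edges E a b A) a b s x) = 0"
    then show "realizable A (induced_edges E a b A) a b
        (\<lambda>x. g x - boundary (E - induced_edges E a b A) a b s x)"
      using psubset_card_mono[OF finV A(1)] tight
      by (intro smaller[OF config_inside[OF config A0 A(1) _ _ refl refl _ refl]]) auto
  qed (use A in auto)
  then show False using not_realizable by blast
qed

lemma card_V: "2 \<le> card V"
proof (rule ccontr)
  assume "\<not> 2 \<le> card V"
  then have "card V = 1" using V_ne finV by (metis One_nat_def card_0_eq less_2_cases not_le)
  then obtain x where x: "V = {x}" by (auto simp: card_1_singleton_iff)
  then have "boundary E a b (\<lambda>_. 1) x = 0"
    unfolding boundary_def using ends_in by (intro sum.neutral) auto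
  then have "realizable V E a b g"
    using sum_g x unfolding realizable_def by (intro exI[of _ "\<lambda>_. 1"]) auto
  then show False using not_realizable by blast
qed

lemma singleton_psubset: "x \<in> V \<Longrightarrow> {x} \<subset> V"
  using card_V by (metis card_1_singleton_iff empty_subsetI insert_subset numeral_le_one_iff
      psubsetI semiring_norm(69) One_nat_def)

lemma deg_vertex: "x \<in> V \<Longrightarrow> 4 + tau (d {x}) (\<beta> x) \<le> d {x}"
  using deg_ge[of "{x}"] singleton_psubset[of x] by simp

lemma no_loop:
  assumes e: "e \<in> E" shows "a e \<noteq> b e"
proof
  assume eq: "a e = b e"
  have d: "tdeg (E - {e}) a b m A = d A" for A
    using cut_deg_remove[OF finE e, of a b A] eq by (simp add: tdeg_def)
  have "config V (E - {e}) a b g m \<beta>"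
    using config unfolding config_def d by (auto simp: ref_graph_def)
  moreover have "card (E - {e}) < card E" using e finE by (meson card_Diff1_less)
  ultimately have "realizable V (E - {e}) a b g" by (intro smaller) auto
  then have "realizable V E a b g"
    using realizable_delete[OF finE e, of "a e" a b 1 V g] eq by (simp add: far_def)
  then show False using not_realizable by blast
qed

sublocale loopless V E a b
  by unfold_locales (fact ref_graph no_loop)+

lemma no_parallel:
  assumes e: "e1 \<in> E" "e2 \<in> E" "e1 \<noteq> e2" and x: "x \<in> {a e1, b e1}" "x \<in> {a e2, b e2}"
  shows "far a b x e1 \<noteq> far a b x e2"
proof
  assume eq: "far a b x e1 = far a b x e2"
  define y where "y = far a b x e1"
  have xy: "x \<noteq> y" "{a e1, b e1} = {x, y}" "{a e2, b e2} = {x, y}"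
    using no_loop[OF e(1)] no_loop[OF e(2)] x eq by (auto simp: y_def far_def split: if_splits)
  have xyV: "x \<in> V" "y \<in> V" using xy e ends_in by (metis insertCI insertE singletonD)+
  have "card (collapse {x, y} x ` V) < card V"
    using xyV xy finV by (intro card_collapse) auto
  then have "realizable (collapse {x, y} x ` V) E (collapse {x, y} x \<circ> a) (collapse {x, y} x \<circ> b)
      (push (collapse {x, y} x) V g)"
    by (intro smaller[OF config_push[OF config]]) simp
  then have "realizable V E a b g" by (rule realizable_contract_parallel[OF graph e xy])
  then show False using not_realizable by blast
qed

text \<open>
  The two sides of a disconnection would have at least 8 edges to \<open>z\<^sub>0\<close>, which has degree at most 7.
\<close>

lemma cut_deg_pos:
  assumes A: "A \<noteq> {}" "A \<subset> V"
  shows "0 < cut_deg E a b A"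
proof (rule ccontr)
  assume z: "\<not> 0 < cut_deg E a b A"
  have B: "V - A \<noteq> {}" "V - A \<subset> V" using A by auto
  have "sum m V = sum m (V - A) + sum m A" using finV A by (intro sum.subset_diff) auto
  moreover have "d A = sum m A" "d (V - A) = sum m (V - A)"
    using z cut_deg_compl[OF graph, of A] A by (auto simp: tdeg_def)
  ultimately show False
    using deg_ge[OF A] deg_ge[OF B] total tau_le_3[of "sum m V" "sum \<beta> V"] by linarith
qed

lemma d_vertex: "d {x} = card (star x) + m x"
  by (simp add: tdeg_def card_star)

lemma star_ne: "x \<in> V \<Longrightarrow> star x \<noteq> {}"
  using cut_deg_pos[of "{x}"] singleton_psubset card_star[of x] by force

text \<open>Single vertices, where a reduction must be checked exactly, are separated from larger
  sets, which by \<open>not_tight\<close> can spare two edges.\<close>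

lemma proper_cases:
  assumes "A \<noteq> {}" "A \<subset> V"
  obtains y where "y \<in> V" "A = {y}" | "2 \<le> card A" "6 + tau (d A) (sum \<beta> A) \<le> d A" "finite A"
proof -
  have fA: "finite A" using assms finV finite_subset by blast
  show thesis
  proof (cases "2 \<le> card A")
    case True
    then show ?thesis using that(2) not_tight[OF assms(2)] fA by blast
  next
    case False
    then have "card A = 1" using assms fA by (metis One_nat_def card_0_eq less_2_cases not_le)
    then show ?thesis using that(1) assms by (auto simp: card_1_singleton_iff)
  qed
qed

lemma smaller_edges:
  assumes "E' \<subset> E" "config V E' a' b' g' m' \<beta>'"
  shows "realizable V E' a' b' g'"
  using assms psubset_card_mono[OF finE assms(1)] by (intro smaller) auto

text \<open>
  An edge is deleted when some direction of it lowers \<open>tau\<close> at both ends.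
\<close>

lemma no_drop:
  assumes e: "e \<in> star x" and y: "y = far a b x e" and \<sigma>: "\<sigma> \<noteq> 0"
    and x_drop: "tau (d {x} - 1) (\<beta> x - \<sigma>) < tau (d {x}) (\<beta> x)"
    and y_drop: "tau (d {y} - 1) (\<beta> y + \<sigma>) < tau (d {y}) (\<beta> y)"
  shows False
proof -
  note f = star_far(1-5)[OF e, folded y]
  let ?g = "\<lambda>v. g v - \<sigma> * (of_bool (x = v) - of_bool (y = v))"
  let ?\<beta> = "\<lambda>v. \<beta> v - \<sigma> * (of_bool (x = v) - of_bool (y = v))"
  have dd: "d A = tdeg (E - {e}) a b m A + of_bool ((x \<in> A) \<noteq> (y \<in> A))" for A
    using cut_deg_delete[where a=a and b=b, OF finE f(1,2), of A] by (simp add: tdeg_def y)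
  have "config V (E - {e}) a b ?g m ?\<beta>"
  proof (rule configI)
    show "ref_graph V (E - {e}) a b" using graph by (auto simp: ref_graph_def)
    show "sum ?g V = 0" using f sum_g by (simp add: sum_transfer[OF finV])
    show "sum m V \<le> 4 + tau (sum m V) (sum ?\<beta> V)"
      using f total by (simp add: sum_transfer[OF finV])
  next
    fix A assume A: "A \<noteq> {}" "A \<subset> V"
    then show "4 + tau (tdeg (E - {e}) a b m A) (sum ?\<beta> A) \<le> tdeg (E - {e}) a b m A"
    proof (cases rule: proper_cases)
      case (1 v)
      consider "v = x" | "v = y" | "v \<noteq> x" "v \<noteq> y" by blast
      then show ?thesis
      proof cases
        assume "v = x"
        then show ?thesis using deg_vertex[of x] dd[of "{x}"] f(4,5) x_drop 1 by simp
      next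
        assume "v = y"
        then show ?thesis using deg_vertex[of y] dd[of "{y}"] f(3,4) y_drop 1 by simp
      next
        assume "v \<noteq> x" "v \<noteq> y"
        then show ?thesis using deg_vertex[of v] dd[of "{v}"] 1 by simp
      qed
    next
      case 2
      show ?thesis unfolding sum_transfer[OF 2(3)]
        by (rule tau_slack[OF 2(2)])
          (use \<sigma> dd[of A] in \<open>auto split: if_splits\<close>)
    qed
  qed (use V_ne compat in auto)
  then have "realizable V (E - {e}) a b ?g" using f(1) by (intro smaller_edges) auto
  then have "realizable V E a b g"
    using realizable_delete[where a=a and b=b, OF finE f(1,2) \<sigma>, of V g] by (simp add: y)
  then show False using not_realizable by blast
qed


text \<open>An edge from \<open>z\<^sub>0\<close> to \<open>x\<close> is lifted together with an
  edge from \<open>x\<close> to \<open>y\<close> into an edge from \<open>z\<^sub>0\<close> to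
  \<open>y\<close>. Among the single vertices only \<open>x\<close> loses degree, namely 2, which
  the excess covers.\<close>

lemma no_excess_weighted:
  assumes x: "x \<in> V" "m x \<noteq> 0"
  shows "d {x} < 6 + tau (d {x}) (\<beta> x)"
proof (rule ccontr)
  assume ex: "\<not> d {x} < 6 + tau (d {x}) (\<beta> x)"
  obtain e where e: "e \<in> star x" using star_ne[OF x(1)] by blast
  define y where "y = far a b x e"
  note f = star_far(1-5)[OF e, folded y_def]
  \<comment> \<open>The weight at \<open>x\<close> falls by one: when it reaches 0 the new demand
    must equal \<open>\<beta> x\<close>, when it reaches 1 it must differ from it.\<close>
  obtain c :: 3 where c: "c \<noteq> 0" "m x = 1 \<Longrightarrow> g x - c = \<beta> x" "m x = 2 \<Longrightarrow> g x - c \<noteq> \<beta> x"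
  proof (cases "m x = 1")
    case True
    then show ?thesis using that[of "g x - \<beta> x"] compat(2)[OF x(1)] by auto
  next
    case False
    show ?thesis
    proof (cases "g x - 1 = \<beta> x")
      case True
      then have "g x = \<beta> x + 1" by (simp add: algebra_simps)
      then show ?thesis using that[of "-1"] False by simp
    next
      case F: False
      then show ?thesis using that[of 1] False by simp
    qed
  qed
  obtain k where k: "m x = Suc k" using x(2) by (cases "m x") auto
  let ?g = "\<lambda>v. g v - c * (of_bool (x = v) - of_bool (y = v))"
  let ?h = "m(x := k)"
  let ?m = "?h(y := Suc (?h y))"
  have mA: "sum ?m A + of_bool (x \<in> A) = sum m A + of_bool (y \<in> A)" if "finite A" for A
    using sum_upd_Suc[OF that, of ?h y] sum_upd_pred[of A m x k, OF that k] by linarith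
  have dd: "d A + of_bool (y \<in> A) = tdeg (E - {e}) a b ?m A + of_bool ((x \<in> A) \<noteq> (y \<in> A)) + of_bool (x \<in> A)"
    if "finite A" for A
    using cut_deg_delete[where a=a and b=b, OF finE f(1,2), of A] mA[OF that]
    unfolding tdeg_def y_def by linarith
  have mV: "sum ?m V = sum m V" using mA[OF finV] f by simp
  have "config V (E - {e}) a b ?g ?m \<beta>"
  proof (rule configI)
    show "ref_graph V (E - {e}) a b" using graph by (auto simp: ref_graph_def)
    show "sum ?g V = 0" using f sum_g by (simp add: sum_transfer[OF finV])
    show "sum ?m V \<le> 4 + tau (sum ?m V) (sum \<beta> V)" unfolding mV by (rule total)
  next
    fix v assume v: "v \<in> V"
    consider "v = x" | "v = y" | "v \<noteq> x" "v \<noteq> y" by blast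
    note cs = this
    show "\<beta> v = ?g v" if "?m v = 0"
      using cs that c(2) compat(1)[OF v] f(4) k by cases (auto split: if_splits)
    show "\<beta> v \<noteq> ?g v" if "?m v = 1"
      using cs
    proof cases
      assume "v = y"
      then have "\<beta> v = g v" using that compat(1)[OF v] f(4) by simp
      then show ?thesis using \<open>v = y\<close> f(4) c(1) by simp
    qed (use that c(3) compat(2)[OF v] f(4) k in auto)
  next
    fix A assume A: "A \<noteq> {}" "A \<subset> V"
    then show "4 + tau (tdeg (E - {e}) a b ?m A) (sum \<beta> A) \<le> tdeg (E - {e}) a b ?m A"
    proof (cases rule: proper_cases)
      case (1 v)
      show ?thesis
      proof (cases "v = x")
        case True
        then have D: "tdeg (E - {e}) a b ?m A + 2 = d {x}" using dd[of A] 1 f(4) by auto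
        then have "tau (tdeg (E - {e}) a b ?m A) (\<beta> x) = tau (d {x}) (\<beta> x)"
          by (intro tau_cong_parity) (simp flip: D)
        then show ?thesis using D ex 1 True by simp
      next
        case False
        then have "tdeg (E - {e}) a b ?m A = d {v}" using dd[of A] 1 by auto
        then show ?thesis using deg_vertex[of v] 1 by simp
      qed
    next
      case 2
      show ?thesis
        by (rule tau_slack[OF 2(2)]) (use dd[OF 2(3)] in \<open>cases "x \<in> A"; cases "y \<in> A"; simp\<close>)
    qed
  qed (rule V_ne)
  then have "realizable V (E - {e}) a b ?g" using f(1) by (intro smaller_edges) auto
  then have "realizable V E a b g"
    using realizable_delete[where a=a and b=b, OF finE f(1,2) c(1), of V g] by (simp add: y_def)
  then show False using not_realizable by blast
qed

text \<open>Two edges at \<open>x\<close> are lifted. Their far ends differ, as there are no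
  parallel edges, so no vertex other than \<open>x\<close> loses degree.\<close>

lemma no_excess_unweighted:
  assumes x: "x \<in> V" "m x = 0"
  shows "d {x} < 6 + tau (d {x}) (\<beta> x)"
proof (rule ccontr)
  assume ex: "\<not> d {x} < 6 + tau (d {x}) (\<beta> x)"
  then have "2 \<le> card (star x)" using d_vertex[of x] x by simp
  then obtain e1 e2 where e: "e1 \<in> star x" "e2 \<in> star x" "e1 \<noteq> e2"
    by (metis card_le_Suc0_iff_eq finE finite_subset not_less_eq_eq numeral_2_eq_2 star_E)
  define y1 y2 where "y1 = far a b x e1" and "y2 = far a b x e2"
  note f1 = star_far(1-5)[OF e(1), folded y1_def] and f2 = star_far(1-5)[OF e(2), folded y2_def]
  have y: "y1 \<noteq> y2" unfolding y1_def y2_def using no_parallel f1 f2 e(3) by blast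
  let ?a = "a(e1 := y2)" and ?b = "b(e1 := y1)"
  have dd: "tdeg (E - {e2}) ?a ?b m A + of_bool ((x \<in> A) \<noteq> (y1 \<in> A)) + of_bool ((x \<in> A) \<noteq> (y2 \<in> A))
      = d A + of_bool ((y1 \<in> A) \<noteq> (y2 \<in> A))" for A
    using cut_deg_lift[where a=a and b=b, OF finE f1(1) f2(1) e(3) f1(2) f2(2), of A]
    by (simp add: tdeg_def y1_def y2_def)
  have "config V (E - {e2}) ?a ?b g m \<beta>"
  proof (rule configI)
    show "ref_graph V (E - {e2}) ?a ?b" using graph f1 f2 by (auto simp: ref_graph_def)
  next
    fix A assume A: "A \<noteq> {}" "A \<subset> V"
    then show "4 + tau (tdeg (E - {e2}) ?a ?b m A) (sum \<beta> A) \<le> tdeg (E - {e2}) ?a ?b m A"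
    proof (cases rule: proper_cases)
      case (1 v)
      show ?thesis
      proof (cases "v = x")
        case True
        then have D: "tdeg (E - {e2}) ?a ?b m A + 2 = d {x}" using dd[of A] 1 f1(4) f2(4) by auto
        then have "tau (tdeg (E - {e2}) ?a ?b m A) (\<beta> x) = tau (d {x}) (\<beta> x)"
          by (intro tau_cong_parity) (simp flip: D)
        then show ?thesis using D ex 1 True by simp
      next
        case False
        then have "tdeg (E - {e2}) ?a ?b m A = d {v}" using dd[of A] 1 y by (cases "v = y1"; cases "v = y2"; simp)
        then show ?thesis using deg_vertex[of v] 1 by simp
      qed
    next
      case 2
      show ?thesis
        by (rule tau_slack[OF 2(2)]) (use dd[of A] in \<open>cases "x \<in> A"; cases "y1 \<in> A"; cases "y2 \<in> A"; simp\<close>)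
    qed
  qed (use V_ne compat sum_g total in auto)
  then have "realizable V (E - {e2}) ?a ?b g" using f2(1) by (intro smaller_edges) auto
  then have "realizable V E a b g"
    unfolding y1_def y2_def
    using realizable_lift[where a=a and b=b, OF finE f1(1) f2(1) e(3) f1(2) f2(2)] by blast
  then show False using not_realizable by blast
qed

text \<open>The excess is below 2, and it is even because \<open>tau\<close> has the parity of the
  degree.\<close>

lemma vertex_tight:
  assumes x: "x \<in> V"
  shows "d {x} = 4 + tau (d {x}) (\<beta> x)"
proof -
  have "d {x} < 6 + tau (d {x}) (\<beta> x)"
    using no_excess_weighted no_excess_unweighted x by blast
  then consider "d {x} = 4 + tau (d {x}) (\<beta> x)" | "d {x} = 5 + tau (d {x}) (\<beta> x)"
    using deg_vertex[OF x] by linarith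
  then show ?thesis
  proof cases
    case 2
    then have "even (d {x}) = even (5 + tau (d {x}) (\<beta> x))" by (rule arg_cong)
    then show ?thesis by (simp add: even_tau)
  qed
qed


text \<open>As \<open>\<beta> x = 0\<close>, a set \<open>A\<close> avoiding \<open>x\<close> has
  the same prescription as \<open>insert x A\<close> and may be compared with either. The middle
  alternative spends the two edges that a set with two vertices can spare.\<close>

lemma realizable_remove_balanced:
  assumes x: "x \<in> V" "\<beta> x = 0"
    and E': "E' \<subseteq> E" "\<And>e. e \<in> E' \<Longrightarrow> a' e \<in> V - {x} \<and> b' e \<in> V - {x}"
    and g': "sum g' V = 0" "g' x = 0"
    and m': "sum m' (V - {x}) = sum m V"
    and compat': "\<And>v. v \<in> V - {x} \<Longrightarrow> m' v = 0 \<Longrightarrow> \<beta> v = g' v"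
      "\<And>v. v \<in> V - {x} \<Longrightarrow> m' v = 1 \<Longrightarrow> \<beta> v \<noteq> g' v"
    and deg': "\<And>A. A \<subseteq> V - {x} \<Longrightarrow> finite A \<Longrightarrow> tdeg E' a' b' m' A = d A
      \<or> 2 \<le> card A \<and> tdeg E' a' b' m' A + 2 = d A
      \<or> tdeg E' a' b' m' A = d (insert x A)"
  shows "realizable V E' a' b' g'"
proof (rule realizable_remove_vertex[where x = x])
  show "\<forall>e\<in>E'. a' e \<noteq> x \<and> b' e \<noteq> x" using E' by blast
  have \<beta>: "sum \<beta> (V - {x}) = sum \<beta> V" "sum g' (V - {x}) = sum g' V"
    using x g' finV by (simp_all add: sum.remove)
  have "config (V - {x}) E' a' b' g' m' \<beta>"
  proof (rule configI)
    show "ref_graph (V - {x}) E' a' b'"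
      using E' finV finE finite_subset by (auto simp: ref_graph_def)
    show "V - {x} \<noteq> {}" using singleton_psubset[OF x(1)] by blast
    show "sum g' (V - {x}) = 0" using g' \<beta> by simp
    show "sum m' (V - {x}) \<le> 4 + tau (sum m' (V - {x})) (sum \<beta> (V - {x}))"
      unfolding m' \<beta> by (rule total)
  next
    fix A assume A: "A \<noteq> {}" "A \<subset> V - {x}"
    then have AV: "A \<subset> V" "A \<subseteq> V - {x}" "finite A" "insert x A \<subset> V" "x \<notin> A"
      using x finV finite_subset by (auto simp: psubset_eq)
    have \<beta>x: "sum \<beta> (insert x A) = sum \<beta> A" using AV x by simp
    from deg'[OF AV(2,3)] show "4 + tau (tdeg E' a' b' m' A) (sum \<beta> A) \<le> tdeg E' a' b' m' A"
    proof (elim disjE)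
      assume "tdeg E' a' b' m' A = d A"
      then show ?thesis using deg_ge[OF A(1) AV(1)] by simp
    next
      assume "2 \<le> card A \<and> tdeg E' a' b' m' A + 2 = d A"
      then show ?thesis by (intro tau_slack[OF not_tight[OF AV(1)]]) auto
    next
      assume "tdeg E' a' b' m' A = d (insert x A)"
      then show ?thesis using deg_ge[of "insert x A"] AV(4) \<beta>x by simp
    qed
  qed (use compat' in auto)
  moreover have "card (V - {x}) < card V" using x finV by (meson card_Diff1_less)
  ultimately show "realizable (V - {x}) E' a' b' g'" by (intro smaller) auto
qed (rule g')

text \<open>Lifting the four edges in two pairs isolates \<open>x\<close>. A set loses 2 edges for
  each pair of neighbours that it contains.\<close>

lemma not_balanced_weight_0:
  assumes x: "x \<in> V" "\<beta> x = 0" and m: "m x = 0" and card: "card (star x) = 4"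
  shows False
proof -
  obtain e1 S1 where S1: "star x = insert e1 S1" "e1 \<notin> S1" "card S1 = 3"
    using card card_Suc_eq[of "star x" 3] by auto
  then obtain e2 e3 e4 where S: "star x = {e1, e2, e3, e4}"
    and ne: "e1 \<noteq> e2" "e1 \<noteq> e3" "e1 \<noteq> e4" "e2 \<noteq> e3" "e2 \<noteq> e4" "e3 \<noteq> e4"
    unfolding card_3_iff by auto
  define y1 y2 y3 y4 where y: "y1 = far a b x e1" "y2 = far a b x e2" "y3 = far a b x e3" "y4 = far a b x e4"
  have es: "e1 \<in> star x" "e2 \<in> star x" "e3 \<in> star x" "e4 \<in> star x" using S by auto
  note f = star_far(1-4)[OF es(1), folded y] star_far(1-4)[OF es(2), folded y]
    star_far(1-4)[OF es(3), folded y] star_far(1-4)[OF es(4), folded y]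
  have yne: "y1 \<noteq> y2" "y3 \<noteq> y4" unfolding y using no_parallel f ne by blast+
  let ?a1 = "a(e1 := y2)" and ?b1 = "b(e1 := y1)"
  let ?a2 = "?a1(e3 := y4)" and ?b2 = "?b1(e3 := y3)"
  have far1: "far ?a1 ?b1 x e3 = y3" "far ?a1 ?b1 x e4 = y4"
    using ne by (auto simp: far_def y)
  have fin1: "finite (E - {e2})" and in1: "e3 \<in> E - {e2}" "e4 \<in> E - {e2}" using finE f ne by auto
  have x1: "x \<in> {?a1 e3, ?b1 e3}" "x \<in> {?a1 e4, ?b1 e4}" using ne f by auto
  have dd: "tdeg (E - {e2} - {e4}) ?a2 ?b2 m A + of_bool (y1 \<in> A) + of_bool (y2 \<in> A)
      + of_bool (y3 \<in> A) + of_bool (y4 \<in> A)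
      = d A + of_bool ((y1 \<in> A) \<noteq> (y2 \<in> A)) + of_bool ((y3 \<in> A) \<noteq> (y4 \<in> A))" if "x \<notin> A" for A
    using cut_deg_lift[where a=a and b=b, OF finE f(1,5) ne(1) f(2,6), of A, folded y]
      cut_deg_lift[where a="?a1" and b="?b1", OF fin1 in1 ne(6) x1, of A, unfolded far1] that
    by (simp add: tdeg_def)
  have gx: "g x = 0" using compat(1)[OF x(1)] x m by simp
  have "realizable V (E - {e2} - {e4}) ?a2 ?b2 g"
  proof (rule realizable_remove_balanced[OF x, where m' = m])
    show "E - {e2} - {e4} \<subseteq> E" by blast
    fix e assume e: "e \<in> E - {e2} - {e4}"
    then have "e = e1 \<or> e = e3 \<or> e \<notin> star x" using S by blast
    then show "?a2 e \<in> V - {x} \<and> ?b2 e \<in> V - {x}"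
      using e f ne ends_in[of e] by (auto simp: star_def)
  next
    show "sum m (V - {x}) = sum m V" using m x finV by (simp add: sum.remove)
  next
    fix A assume A: "A \<subseteq> V - {x}" "finite A"
    then have xA: "x \<notin> A" by blast
    have two: "2 \<le> card A" if "u \<in> A" "v \<in> A" "u \<noteq> v" for u v
      using that A(2) card_mono[of A "{u, v}"] by simp
    show "tdeg (E - {e2} - {e4}) ?a2 ?b2 m A = d A
      \<or> 2 \<le> card A \<and> tdeg (E - {e2} - {e4}) ?a2 ?b2 m A + 2 = d A
      \<or> tdeg (E - {e2} - {e4}) ?a2 ?b2 m A = d (insert x A)"
    \<comment> \<open>With all four neighbours in \<open>A\<close> the loss is 4, too much for
      \<open>A\<close> itself, but then \<open>insert x A\<close> already has 4 edges fewer than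
      \<open>A\<close>.\<close>
    proof (cases "y1 \<in> A \<and> y2 \<in> A \<and> y3 \<in> A \<and> y4 \<in> A")
      case True
      then have "{e\<in>star x. far a b x e \<in> A} = star x" using S y by auto
      then have "d (insert x A) + 4 = d A"
        using cut_deg_insert[OF xA] card m xA A by (simp add: tdeg_def)
      then show ?thesis using dd[OF xA] True by simp
    next
      case False
      then show ?thesis using dd[OF xA] two[of y1 y2] two[of y3 y4] yne
        by (cases "y1 \<in> A"; cases "y2 \<in> A"; cases "y3 \<in> A"; cases "y4 \<in> A"; simp)
    qed
  qed (use sum_g gx compat in auto)
  then have "realizable V (E - {e2}) ?a1 ?b1 g"
    using realizable_lift[where a="?a1" and b="?b1", OF fin1 in1 ne(6) x1, of V g, unfolded far1]
    by blast
  then have "realizable V E a b g"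
    using realizable_lift[where a=a and b=b, OF finE f(1,5) ne(1) f(2,6), of V g, folded y] by blast
  then show False using not_realizable by blast
qed

text \<open>The edge to \<open>z\<^sub>0\<close> is lifted with \<open>e3\<close>, and
  \<open>e1\<close> with \<open>e2\<close>. The value on \<open>e3\<close> must be
  \<open>g x\<close>, which is nonzero because weight 1 forces \<open>g x\<close> to differ from
  \<open>\<beta> x = 0\<close>.\<close>

lemma not_balanced_weight_1:
  assumes x: "x \<in> V" "\<beta> x = 0" and m: "m x = 1" and card: "card (star x) = 3"
  shows False
proof -
  obtain e1 e2 e3 where S: "star x = {e1, e2, e3}"
    and ne: "e1 \<noteq> e2" "e1 \<noteq> e3" "e2 \<noteq> e3"
    using card unfolding card_3_iff by auto
  define y1 y2 y3 where y: "y1 = far a b x e1" "y2 = far a b x e2" "y3 = far a b x e3"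
  have es: "e1 \<in> star x" "e2 \<in> star x" "e3 \<in> star x" using S by auto
  note f = star_far(1-4)[OF es(1), folded y] star_far(1-4)[OF es(2), folded y]
    star_far(1-4)[OF es(3), folded y]
  have yne: "y1 \<noteq> y2" unfolding y using no_parallel f ne by blast+
  have fin1: "finite (E - {e3})" and in1: "e1 \<in> E - {e3}" "e2 \<in> E - {e3}" using finE f ne by auto
  define c where "c = g x"
  have c: "c \<noteq> 0" using compat(2)[OF x(1) m] x by (simp add: c_def)
  let ?a1 = "a(e1 := y2)" and ?b1 = "b(e1 := y1)"
  let ?g = "\<lambda>v. g v - c * (of_bool (x = v) - of_bool (y3 = v))"
  let ?m = "m(y3 := Suc (m y3))"
  have dd: "tdeg (E - {e3} - {e2}) ?a1 ?b1 ?m A + of_bool (y1 \<in> A) + of_bool (y2 \<in> A)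
      = d A + of_bool ((y1 \<in> A) \<noteq> (y2 \<in> A))" if "x \<notin> A" "finite A" for A
    using cut_deg_lift[where a=a and b=b, OF fin1 in1 ne(1) f(2,6), of A, folded y]
      cut_deg_delete[where a=a and b=b, OF finE f(9,10), of A, folded y] sum_upd_Suc[OF that(2), of m y3]
      that(1) by (simp add: tdeg_def)
  have "realizable V (E - {e3} - {e2}) ?a1 ?b1 ?g"
  proof (rule realizable_remove_balanced[OF x, where m' = ?m])
    fix e assume e: "e \<in> E - {e3} - {e2}"
    then have "e = e1 \<or> e \<notin> star x" using S by blast
    then show "?a1 e \<in> V - {x} \<and> ?b1 e \<in> V - {x}"
      using e f ne ends_in[of e] by (auto simp: star_def)
  next
    have "sum m V = 1 + sum m (V - {x})" using m x finV by (simp add: sum.remove)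
    then show "sum ?m (V - {x}) = sum m V"
      using sum_upd_Suc[of "V - {x}" m y3] finV f by simp
    show "sum ?g V = 0" using sum_g x f by (simp add: sum_transfer[OF finV])
    show "?g x = 0" using f by (simp add: c_def)
  next
    fix v assume v: "v \<in> V - {x}"
    show "\<beta> v = ?g v" if "?m v = 0"
      using that compat(1)[of v] v by (auto split: if_splits)
    show "\<beta> v \<noteq> ?g v" if "?m v = 1"
      using that compat[of v] v c by (cases "v = y3") auto
  next
    fix A assume A: "A \<subseteq> V - {x}" "finite A"
    then have xA: "x \<notin> A" by blast
    have "2 \<le> card A" if "y1 \<in> A" "y2 \<in> A"
      using that A(2) card_mono[of A "{y1, y2}"] yne by simp
    then show "tdeg (E - {e3} - {e2}) ?a1 ?b1 ?m A = d A
      \<or> 2 \<le> card A \<and> tdeg (E - {e3} - {e2}) ?a1 ?b1 ?m A + 2 = d A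
      \<or> tdeg (E - {e3} - {e2}) ?a1 ?b1 ?m A = d (insert x A)"
      using dd[OF xA A(2)] by (cases "y1 \<in> A"; cases "y2 \<in> A"; simp)
  qed blast
  then have "realizable V (E - {e3}) a b ?g"
    using realizable_lift[where a=a and b=b, OF fin1 in1 ne(1) f(2,6), of V ?g, folded y] by blast
  then have "realizable V E a b g"
    using realizable_delete[where a=a and b=b, OF finE f(9,10) c, of V g, folded y] by blast
  then show False using not_realizable by blast
qed

text \<open>Each edge to \<open>z\<^sub>0\<close> is lifted with one of \<open>e1\<close> and
  \<open>e2\<close>, so every set avoiding \<open>x\<close> keeps its degree.\<close>

lemma not_balanced_weight_2:
  assumes x: "x \<in> V" "\<beta> x = 0" and m: "m x = 2" and card: "card (star x) = 2"
  shows False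
proof -
  obtain e1 e2 where S: "star x = {e1, e2}" and ne: "e1 \<noteq> e2"
    using card unfolding card_2_iff by auto
  define y1 y2 where y: "y1 = far a b x e1" "y2 = far a b x e2"
  have es: "e1 \<in> star x" "e2 \<in> star x" using S by auto
  note f = star_far(1-4)[OF es(1), folded y] star_far(1-4)[OF es(2), folded y]
  have yne: "y1 \<noteq> y2" unfolding y using no_parallel f ne by blast+
  have fin1: "finite (E - {e1})" and in1: "e2 \<in> E - {e1}" using finE f ne by auto
  obtain c1 c2 :: 3 where c: "c1 \<noteq> 0" "c2 \<noteq> 0" "g x = c1 + c2"
  proof (cases "g x" rule: z3_cases)
    case 1 then show ?thesis using that[of 1 "-1"] by simp
  next
    case 2 then show ?thesis using that[of "-1" "-1"] by simp
  next
    case 3 then show ?thesis using that[of 1 1] by simp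
  qed
  let ?g1 = "\<lambda>v. g v - c1 * (of_bool (x = v) - of_bool (y1 = v))"
  let ?g = "\<lambda>v. ?g1 v - c2 * (of_bool (x = v) - of_bool (y2 = v))"
  let ?k = "m(y1 := Suc (m y1))"
  let ?m = "?k(y2 := Suc (?k y2))"
  have mA: "sum ?m A = sum m A + of_bool (y1 \<in> A) + of_bool (y2 \<in> A)" if "finite A" for A
    using sum_upd_Suc[OF that, of ?k y2] sum_upd_Suc[OF that, of m y1] by linarith
  have dd: "tdeg (E - {e1} - {e2}) a b ?m A = d A" if "x \<notin> A" "finite A" for A
    using cut_deg_delete[where a=a and b=b, OF fin1 in1 f(6), of A, folded y]
      cut_deg_delete[where a=a and b=b, OF finE f(1,2), of A, folded y] mA[OF that(2)]
      that(1) by (simp add: tdeg_def)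
  have "realizable V (E - {e1} - {e2}) a b ?g"
  proof (rule realizable_remove_balanced[OF x, where m' = ?m])
    fix e assume e: "e \<in> E - {e1} - {e2}"
    then have "e \<notin> star x" using S by blast
    then show "a e \<in> V - {x} \<and> b e \<in> V - {x}"
      using e ends_in[of e] by (auto simp: star_def)
  next
    have "sum m V = 2 + sum m (V - {x})" using m x finV by (simp add: sum.remove)
    then show "sum ?m (V - {x}) = sum m V"
      using mA[of "V - {x}"] finV f by simp
    have "sum ?g V = sum ?g1 V" using x f sum_transfer[OF finV, of ?g1 c2 x y2] by simp
    also have "\<dots> = 0" using x f sum_g sum_transfer[OF finV, of g c1 x y1] by simp
    finally show "sum ?g V = 0" .
    show "?g x = 0" using f c by simp
  next
    fix v assume v: "v \<in> V - {x}"
    show "\<beta> v = ?g v" if "?m v = 0"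
      using that compat(1)[of v] v by (auto split: if_splits)
    show "\<beta> v \<noteq> ?g v" if "?m v = 1"
      using that compat[of v] v c yne by (cases "v = y1"; cases "v = y2") auto
  next
    fix A assume A: "A \<subseteq> V - {x}" "finite A"
    then show "tdeg (E - {e1} - {e2}) a b ?m A = d A
      \<or> 2 \<le> card A \<and> tdeg (E - {e1} - {e2}) a b ?m A + 2 = d A
      \<or> tdeg (E - {e1} - {e2}) a b ?m A = d (insert x A)"
      using dd[of A] by blast
  qed blast
  then have "realizable V (E - {e1}) a b ?g1"
    using realizable_delete[where a=a and b=b, OF fin1 in1 f(6) c(2), of V ?g1, folded y] by blast
  then have "realizable V E a b g"
    using realizable_delete[where a=a and b=b, OF finE f(1,2) c(1), of V g, folded y] by blast
  then show False using not_realizable by blast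
qed

text \<open>The rest of the graph has 2 edges fewer to its outside than \<open>z\<^sub>0\<close>
  has, with the same parity and prescription. The lower bound for its cut then exceeds the upper
  bound for \<open>z\<^sub>0\<close>.\<close>

lemma not_balanced_weight_3:
  assumes x: "x \<in> V" "\<beta> x = 0" and m: "m x = 3" and card: "card (star x) = 1"
  shows False
proof -
  have "V - {x} \<noteq> {}" "V - {x} \<subset> V" using singleton_psubset[OF x(1)] x by blast+
  then have ge: "4 + tau (d (V - {x})) (sum \<beta> (V - {x})) \<le> d (V - {x})" by (rule deg_ge)
  have "sum m V = 3 + sum m (V - {x})" "sum \<beta> (V - {x}) = sum \<beta> V"
    using m x finV by (simp_all add: sum.remove)
  moreover have "cut_deg E a b (V - {x}) = 1"
    using cut_deg_compl[OF graph, of "{x}"] x card card_star by simp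
  ultimately have D: "sum m V = d (V - {x}) + 2" "sum \<beta> (V - {x}) = sum \<beta> V"
    by (simp_all add: tdeg_def)
  then have "tau (sum m V) (sum \<beta> V) = tau (d (V - {x})) (sum \<beta> V)"
    by (intro tau_cong_parity) simp
  then show False using ge total D by simp
qed

text \<open>If \<open>tau\<close> is 0, then \<open>\<beta> x = 0\<close> and tightness gives degree
  4. At least one of the four edges does not go to \<open>z\<^sub>0\<close>, which leaves weights 0
  to 3.\<close>

lemma tau_vertex_pos:
  assumes x: "x \<in> V"
  shows "0 < tau (d {x}) (\<beta> x)"
proof (rule ccontr)
  assume "\<not> 0 < tau (d {x}) (\<beta> x)"
  then have t: "\<beta> x = 0" "d {x} = 4"
    using vertex_tight[OF x] by (auto simp: tau_def split: if_splits)
  have "card (star x) \<noteq> 0" using star_ne[OF x] star_E finE finite_subset by fastforce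
  then consider "m x = 0" "card (star x) = 4" | "m x = 1" "card (star x) = 3"
    | "m x = 2" "card (star x) = 2" | "m x = 3" "card (star x) = 1"
    using t(2) d_vertex[of x] by linarith
  then show False
    using not_balanced_weight_0 not_balanced_weight_1 not_balanced_weight_2 not_balanced_weight_3
      x t(1) by cases blast+
qed

end

section \<open>One sign for all vertices, and the final contradiction\<close>

lemma cut_deg_posE:
  assumes "0 < cut_deg E a b A"
  obtains e where "e \<in> E" "(a e \<in> A) \<noteq> (b e \<in> A)"
proof -
  have "\<exists>e\<in>E. (a e \<in> A) \<noteq> (b e \<in> A)"
  proof (rule ccontr)
    assume "\<not> ?thesis"
    then have "cut_deg E a b A = 0" unfolding cut_deg_def by (intro sum.neutral) simp
    then show False using assms by simp
  qed
  then show thesis using that by blast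
qed

text \<open>Here \<open>M\<close> is the degree of \<open>z\<^sub>0\<close> when all its edges point
  the same way. For \<open>M = 6\<close> and \<open>M = 7\<close> the value of \<open>tau\<close> is
  only 0 and 1.\<close>

lemma tau_source_le_5:
  assumes "\<sigma> = 1 \<or> \<sigma> = (-1 :: 3)" "M \<le> 4 + tau M (- \<sigma> * of_nat M)"
  shows "M \<le> 5"
proof -
  have "M \<le> 7" using assms(2) tau_le_3[of M "- \<sigma> * of_nat M"] by linarith
  moreover have "M \<noteq> 6" "M \<noteq> 7" using assms by (auto simp: tau_def)
  ultimately show ?thesis by linarith
qed

text \<open>The degree bound for \<open>z\<^sub>0\<close> survives when one of its \<open>M\<close>
  edges is replaced by two opposite ones, which keeps the prescription and adds 1 to the
  degree.\<close>

lemma tau_source_Suc: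
  assumes "\<sigma> = 1 \<or> \<sigma> = (-1 :: 3)" "M \<noteq> 0" "M \<le> 5"
  shows "M + 1 \<le> 4 + tau (M + 1) (- \<sigma> * of_nat M)"
proof -
  have "M \<in> {1, 2, 3, 4, 5}" using assms by auto
  then show ?thesis using assms(1) by (auto simp: tau_def)
qed

text \<open>One vertex gains an edge at an unchanged value, which reverses the sign; the other
  vertex is unchanged, which fixes the sign.\<close>

lemma type_clash:
  assumes "\<sigma> = 1 \<or> \<sigma> = (-1 :: 3)"
    and "p = 5 \<and> u = \<sigma> \<or> p = 6 \<and> u = - \<sigma>" "(q :: nat) = 5 \<and> v = \<sigma> \<or> q = 6 \<and> v = - \<sigma>"
    and "Suc p = 5 \<and> u = \<rho> \<or> Suc p = 6 \<and> u = - \<rho>" "q = 5 \<and> v = \<rho> \<or> q = 6 \<and> v = - \<rho>"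
  shows False
proof -
  have "\<sigma> = - \<rho>" using assms(2,4) by auto
  moreover have "\<sigma> = \<rho>" using assms(3,5) by auto
  ultimately show False using assms(1) by auto
qed

context critical_config
begin

text \<open>By \<open>no_drop\<close>, adjacent vertices cannot drop for opposite values, while
  every vertex drops for at least one. So none drops for both, which excludes degree 7 with value 0,
  and along the edges of the connected graph the sign is constant.\<close>

lemma uniform:
  obtains \<sigma> :: 3 where "\<sigma> = 1 \<or> \<sigma> = -1"
    and "\<And>x. x \<in> V \<Longrightarrow> d {x} = 5 \<and> \<beta> x = \<sigma> \<or> d {x} = 6 \<and> \<beta> x = - \<sigma>"
proof -
  define drop where "drop x c \<longleftrightarrow> tau (d {x} - 1) (\<beta> x - c) < tau (d {x}) (\<beta> x)" for x c
  have vt: "d {x} = 5 \<and> \<beta> x = c \<or> d {x} = 6 \<and> \<beta> x = - c"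
    if "x \<in> V" "drop x c" "\<not> drop x (- c)" "c = 1 \<or> c = -1" for x c
  proof -
    have "d {x} \<noteq> 0" using vertex_tight[OF that(1)] by simp
    then show ?thesis
      using that(2-4) vertex_tight[OF that(1)]
      by (cases "\<beta> x" rule: z3_cases; cases "even (d {x})") (auto simp: drop_def tau_def)
  qed
  have ex: "drop x 1 \<or> drop x (-1)" if "x \<in> V" for x
  proof -
    have "d {x} \<noteq> 0" using vertex_tight[OF that] by simp
    then show ?thesis
      using tau_vertex_pos[OF that]
      by (cases "\<beta> x" rule: z3_cases; cases "even (d {x})") (auto simp: drop_def tau_def)
  qed
  have no: False if "e \<in> star x" "drop x c" "drop (far a b x e) (- c)" "c = 1 \<or> c = -1" for e x c
    by (rule no_drop[OF that(1) refl, of c]) (use that in \<open>auto simp: drop_def\<close>)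
  have pure: "\<not> (drop x 1 \<and> drop x (-1))" if "x \<in> V" for x
  proof
    assume d: "drop x 1 \<and> drop x (-1)"
    obtain e where e: "e \<in> star x" using star_ne[OF \<open>x \<in> V\<close>] by blast
    show False using ex[OF star_far(3)[OF e]] no[OF e, of 1] no[OF e, of "-1"] d by auto
  qed
  let ?S = "{x\<in>V. drop x 1}"
  have "?S = {} \<or> ?S = V"
  proof (rule ccontr)
    assume "\<not> (?S = {} \<or> ?S = V)"
    then have "0 < cut_deg E a b ?S" by (intro cut_deg_pos) auto
    then obtain e where e: "e \<in> E" "(a e \<in> ?S) \<noteq> (b e \<in> ?S)"
      by (rule cut_deg_posE)
    define x where "x = (if a e \<in> ?S then a e else b e)"
    have "e \<in> star x" using e by (auto simp: star_def x_def)
    moreover have "x \<in> ?S" "far a b x e \<notin> ?S" using e by (auto simp: x_def far_def)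
    ultimately show False using no[of e x 1] ex[of "far a b x e"] star_far(3)[of e x] by auto
  qed
  then show thesis
  proof
    assume S: "?S = {}"
    show thesis
    proof (rule that[of "-1"])
      fix x assume "x \<in> V"
      then show "d {x} = 5 \<and> \<beta> x = - 1 \<or> d {x} = 6 \<and> \<beta> x = - (- 1)"
        using vt[of x "-1"] ex[of x] S by auto
    qed simp
  next
    assume S: "?S = V"
    show thesis
    proof (rule that[of 1])
      fix x assume "x \<in> V"
      then show "d {x} = 5 \<and> \<beta> x = 1 \<or> d {x} = 6 \<and> \<beta> x = - 1"
        using vt[of x 1] pure[of x] S by auto
    qed simp
  qed
qed

text \<open>An edge to \<open>z\<^sub>0\<close> that contributes \<open>c\<close> to the value at
  \<open>x\<close> is deleted. The types in \<open>\<beta>x\<close> are those for which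
  \<open>tau\<close> falls along with the degree.\<close>

lemma config_decrease:
  assumes x: "x \<in> V" "m x = Suc k" and c: "c \<noteq> 0"
    and \<beta>x: "d {x} = 5 \<and> \<beta> x = c \<or> d {x} = 6 \<and> \<beta> x = - c"
    and comp: "m x = 1 \<Longrightarrow> \<beta> x - c = g x" "m x = 2 \<Longrightarrow> \<beta> x - c \<noteq> g x"
  shows "config V E a b g (m(x := k)) (\<beta>(x := \<beta> x - c))"
proof -
  have mA: "sum (m(x := k)) A + of_bool (x \<in> A) = sum m A" if "finite A" for A
    by (rule sum_upd_pred) (use that x in auto)
  have \<beta>A: "sum (\<beta>(x := \<beta> x - c)) A = sum \<beta> A + (if x \<in> A then - c else 0)" if "finite A" for A
    using sum_upd_diff[OF that, of \<beta> x "\<beta> x - c"] by simp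
  have dd: "tdeg E a b (m(x := k)) A + of_bool (x \<in> A) = d A" if "finite A" for A
    using mA[OF that] by (simp add: tdeg_def)
  show ?thesis
  proof (rule configI)
    have eq: "sum m V = Suc (sum (m(x := k)) V)" using mA[OF finV] x by simp
    have "sum \<beta> V \<noteq> sum (\<beta>(x := \<beta> x - c)) V" using \<beta>A[OF finV] x c by simp
    then show "sum (m(x := k)) V \<le>
        4 + tau (sum (m(x := k)) V) (sum (\<beta>(x := \<beta> x - c)) V)"
      using total tau_Suc_le[of "sum \<beta> V" "sum (\<beta>(x := \<beta> x - c)) V" "sum (m(x := k)) V"]
      unfolding eq by linarith
  next
    fix A assume A: "A \<noteq> {}" "A \<subset> V"
    then show "4 + tau (tdeg E a b (m(x := k)) A) (sum (\<beta>(x := \<beta> x - c)) A) \<le> tdeg E a b (m(x := k)) A"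
    proof (cases rule: proper_cases)
      case (1 v)
      show ?thesis
      proof (cases "v = x")
        case True
        then have D: "tdeg E a b (m(x := k)) {x} + 1 = d {x}" using dd[of "{x}"] by simp
        have "c = 1 \<or> c = -1" using c by (cases c rule: z3_cases) auto
        then show ?thesis using \<beta>x D 1 True by (auto simp: tau_def)
      next
        case False
        then show ?thesis using deg_vertex[of v] dd[of "{v}"] 1 by simp
      qed
    next
      case 2
      show ?thesis
        by (rule tau_slack[OF 2(2)]) (use dd[OF 2(3)] \<beta>A[OF 2(3)] c in \<open>cases "x \<in> A"; simp\<close>)
    qed
  qed (use graph V_ne sum_g compat x comp in \<open>auto split: if_splits\<close>)
qed

lemma config_increase:
  assumes x: "x \<in> V"
    and d: "4 + tau (d {x} + 1) \<beta>x \<le> d {x} + 1"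
    and comp: "m x = 0 \<Longrightarrow> \<beta>x \<noteq> g x"
    and tot: "sum m V + 1 \<le> 4 + tau (sum m V + 1) (sum (\<beta>(x := \<beta>x)) V)"
  shows "config V E a b g (m(x := Suc (m x))) (\<beta>(x := \<beta>x))"
proof -
  have mA: "sum (m(x := Suc (m x))) A = sum m A + of_bool (x \<in> A)" if "finite A" for A
    by (rule sum_upd_Suc) (use that x in auto)
  have \<beta>A: "sum (\<beta>(x := \<beta>x)) A = sum \<beta> A" if "x \<notin> A" for A
    using that by (intro sum.cong) auto
  have dd: "tdeg E a b (m(x := Suc (m x))) A = d A + of_bool (x \<in> A)" if "finite A" for A
    using mA[OF that] by (simp add: tdeg_def)
  show ?thesis
  proof (rule configI)
    show "sum (m(x := Suc (m x))) V \<le>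
        4 + tau (sum (m(x := Suc (m x))) V) (sum (\<beta>(x := \<beta>x)) V)"
      using tot mA[OF finV] x by simp
  next
    fix A assume A: "A \<noteq> {}" "A \<subset> V"
    then show "4 + tau (tdeg E a b (m(x := Suc (m x))) A) (sum (\<beta>(x := \<beta>x)) A)
        \<le> tdeg E a b (m(x := Suc (m x))) A"
    proof (cases rule: proper_cases)
      case (1 v)
      show ?thesis
      proof (cases "v = x")
        case True
        then show ?thesis using d dd[of "{x}"] 1 by simp
      next
        case False
        then show ?thesis using deg_vertex[of v] dd[of "{v}"] 1 by simp
      qed
    next
      case 2
      show ?thesis
        by (rule tau_slack[OF 2(2)]) (use dd[OF 2(3)] \<beta>A[of A] in \<open>cases "x \<in> A"; simp\<close>)
    qed
  qed (use graph V_ne sum_g compat x comp in \<open>auto split: if_splits\<close>)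
qed

end

context critical
begin

text \<open>
  All vertices have degree 5 or 6 with the same sign \<open>\<sigma>\<close>, and an edge to \<open>z\<^sub>0\<close> whose deletion lowers
  \<open>tau\<close> is removed, so all edges at \<open>z\<^sub>0\<close> point the same way. Adding one such edge if there is none,
  and otherwise replacing an edge by two edges in the opposite direction, which has the same value
  modulo 3, gives another configuration on the same graph that is not of this uniform shape.
\<close>

lemma not_config: "\<not> config V E a b g m \<beta>"
proof (induction "sum m V" arbitrary: m \<beta> rule: less_induct)
  case less
  show ?case
  proof
    assume "config V E a b g m \<beta>"
    then interpret critical_config V E a b g m \<beta> by unfold_locales
    obtain \<sigma> where \<sigma>: "\<sigma> = 1 \<or> \<sigma> = -1"
      and type: "\<And>x. x \<in> V \<Longrightarrow> d {x} = 5 \<and> \<beta> x = \<sigma> \<or> d {x} = 6 \<and> \<beta> x = - \<sigma>"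
      using uniform by blast
    have \<sigma>0: "\<sigma> \<noteq> 0" using \<sigma> by auto
    have z3: "u = v + \<sigma>" if "u \<noteq> v" "u \<noteq> v - \<sigma>" for u v :: 3
      using \<sigma> that by (cases u rule: z3_cases; cases v rule: z3_cases) auto
    \<comment> \<open>This says that each edge to \<open>z\<^sub>0\<close> contributes
      \<open>- \<sigma>\<close>. Otherwise one could be deleted with contribution \<sigma>, which
      the induction on the total weight forbids; in particular weights above 2 do not occur.\<close>
    have g: "g x = \<beta> x + \<sigma> * of_nat (m x)" if x: "x \<in> V" for x
    proof (cases "m x")
      case 0
      then show ?thesis using compat(1)[OF x] by simp
    next
      case (Suc k)
      have "\<not> config V E a b g (m(x := k)) (\<beta>(x := \<beta> x - \<sigma>))"
        by (rule less) (use sum_upd_pred[OF finV, of m x k] Suc x in simp)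
      then have n: "m x = 1 \<and> \<beta> x - \<sigma> \<noteq> g x \<or> m x = 2 \<and> \<beta> x - \<sigma> = g x"
        using config_decrease[OF x Suc \<sigma>0 type[OF x]] by blast
      then show ?thesis
      proof
        assume "m x = 1 \<and> \<beta> x - \<sigma> \<noteq> g x"
        then show ?thesis using z3[of "g x" "\<beta> x"] compat(2)[OF x] by auto
      next
        assume "m x = 2 \<and> \<beta> x - \<sigma> = g x"
        moreover have "\<sigma> * of_nat 2 = - \<sigma>" using \<sigma> by auto
        ultimately show ?thesis by (metis diff_conv_add_uminus)
      qed
    qed
    have "0 = sum \<beta> V + \<sigma> * of_nat (sum m V)"
      using sum_g by (simp add: g sum.distrib sum_distrib_left)
    then have \<beta>V: "sum \<beta> V = - \<sigma> * of_nat (sum m V)"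
      by (simp add: eq_neg_iff_add_eq_0)
    have mV: "sum m V \<le> 5"
      using tau_source_le_5[OF \<sigma>] total unfolding \<beta>V by blast
    show False
    proof (cases "sum m V = 0")
      case True
      obtain x where x: "x \<in> V" using V_ne by blast
      have m0: "m x = 0" using True finV x by simp
      let ?\<beta> = "\<beta>(x := \<beta> x - \<sigma>)"
      have "config V E a b g (m(x := Suc (m x))) ?\<beta>"
        by (rule config_increase) (use x type[OF x] \<sigma> True compat(1)[OF x m0] in \<open>auto simp: tau_def\<close>)
      then interpret C: critical_config V E a b g "m(x := Suc (m x))" ?\<beta> by unfold_locales
      \<comment> \<open>At \<open>x\<close> there would be degree 6 with value 0, or degree 7 with
        value \<sigma>, and neither is tight.\<close>
      show False
        using C.vertex_tight[OF x] d_vertex[of x] C.d_vertex[of x] type[OF x] \<sigma> by (auto simp: tau_def)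
    next
      case False
      then obtain x where x: "x \<in> V" "m x \<noteq> 0" by (meson sum.neutral)
      have tot: "sum m V + 1 \<le> 4 + tau (sum m V + 1) (sum \<beta> V)"
        using tau_source_Suc[OF \<sigma> False mV] unfolding \<beta>V .
      have "config V E a b g (m(x := Suc (m x))) (\<beta>(x := \<beta> x))"
        by (rule config_increase) (use x type[OF x(1)] \<sigma> tot in \<open>auto simp: tau_def\<close>)
      then interpret C: critical_config V E a b g "m(x := Suc (m x))" \<beta> by unfold_locales simp
      obtain \<rho> where \<rho>: "\<rho> = 1 \<or> \<rho> = -1"
        and type': "\<And>x. x \<in> V \<Longrightarrow> C.d {x} = 5 \<and> \<beta> x = \<rho> \<or> C.d {x} = 6 \<and> \<beta> x = - \<rho>"
        using C.uniform by blast
      have "V \<noteq> {x}" using card_V by auto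
      then obtain y where y: "y \<in> V" "y \<noteq> x" using x by blast
      have "C.d {y} = d {y}" "C.d {x} = Suc (d {x})"
        using d_vertex C.d_vertex y by auto
      then show False
        using type_clash[OF \<sigma> type[OF x(1)] type[OF y(1)]] type'[OF x(1)] type'[OF y(1)] by metis
    qed
  qed
qed

end

theorem config_realizable:
  fixes V :: "'v set" and E :: "'e set"
  assumes "config V E a b g m \<beta>"
  shows "realizable V E a b g"
  using assms
proof (induction "(card V, card E)" arbitrary: V E a b g m \<beta>
    rule: wf_induct_rule[OF wf_lex_prod[OF wf_less_than wf_less_than]])
  case (1 V E a b g m \<beta>)
  show ?case
  proof (rule ccontr)
    assume n: "\<not> realizable V E a b g"
    interpret critical V E a b g
    proof
      fix V' :: "'v set" and E' :: "'e set" and a' b' g' m' \<beta>'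
      assume c: "config V' E' a' b' g' m' \<beta>'"
        and "card V' < card V \<or> card V' = card V \<and> card E' < card E"
      then have "((card V', card E'), (card V, card E)) \<in> less_than <*lex*> less_than" by simp
      then show "realizable V' E' a' b' g'" using 1(1) c by blast
    qed (rule n)
    show False using not_config 1(2) by blast
  qed
qed

section \<open>Graphs dense on all partitions\<close>

definition cross :: "'e set \<Rightarrow> ('e \<Rightarrow> 'v) \<Rightarrow> ('e \<Rightarrow> 'v) \<Rightarrow> ('v \<Rightarrow> nat) \<Rightarrow> nat" where
  "cross E a b f = (\<Sum>e\<in>E. of_bool (f (a e) \<noteq> f (b e)))"

text \<open>
  A partition of \<open>V\<close> is given by the fibres of a labelling. Four edge-disjoint spanning trees put at
  least \<open>4 (\<bar>P\<bar> - 1)\<close> edges between the classes of a partition \<open>P\<close>, and at most 3 of them are new.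
\<close>

definition dense_graph :: "'v set \<Rightarrow> 'e set \<Rightarrow> ('e \<Rightarrow> 'v) \<Rightarrow> ('e \<Rightarrow> 'v) \<Rightarrow> bool" where
  "dense_graph V E a b \<longleftrightarrow> ref_graph V E a b \<and> V \<noteq> {} \<and>
     (\<forall>f. 4 * card (f ` V) \<le> cross E a b f + 7) \<and>
     (\<forall>A. A \<noteq> {} \<longrightarrow> A \<subset> V \<longrightarrow> 2 \<le> cut_deg E a b A)"

lemma dense_push:
  assumes d: "dense_graph V E a b"
  shows "dense_graph (f ` V) E (f \<circ> a) (f \<circ> b)"
proof -
  have G: "ref_graph V E a b" using d by (simp add: dense_graph_def)
  have "4 * card (h ` f ` V) \<le> cross E (f \<circ> a) (f \<circ> b) h + 7" for h
  proof -
    have "4 * card ((h \<circ> f) ` V) \<le> cross E a b (h \<circ> f) + 7"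
      using d unfolding dense_graph_def by blast
    then show ?thesis by (simp add: cross_def image_comp)
  qed
  moreover have "2 \<le> cut_deg E (f \<circ> a) (f \<circ> b) B" if "B \<noteq> {}" "B \<subset> f ` V" for B
  proof -
    have "{x\<in>V. f x \<in> B} \<noteq> {}" "{x\<in>V. f x \<in> B} \<subset> V" using that by auto
    then show ?thesis using d by (simp add: dense_graph_def cut_deg_push[OF G])
  qed
  ultimately show ?thesis using d by (auto simp: dense_graph_def ref_graph_def)
qed

lemma induced_ref_graph:
  assumes "ref_graph V E a b" "A \<subseteq> V"
  shows "ref_graph A (induced_edges E a b A) a b"
  using assms finite_subset by (auto simp: ref_graph_def induced_edges_def)

text \<open>Edges between \<open>B\<close> and \<open>A - B\<close> lie in both cuts on the left,
  edges leaving \<open>A\<close> from either part in exactly one.\<close>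

lemma cut_deg_split:
  assumes "finite E" "B \<subseteq> A"
  shows "cut_deg E a b B + cut_deg E a b (A - B) =
    2 * cut_deg (induced_edges E a b A) a b B + cut_deg E a b A"
proof -
  have "cut_deg (induced_edges E a b A) a b B =
      (\<Sum>e\<in>E. of_bool (e \<in> induced_edges E a b A \<and> (a e \<in> B) \<noteq> (b e \<in> B)))"
    unfolding cut_deg_def using assms(1)
    by (intro sum.mono_neutral_cong_left) (auto simp: induced_edges_def)
  note I = this
  show ?thesis
    unfolding I unfolding cut_deg_def sum_distrib_left sum.distrib[symmetric]
    by (intro sum.cong refl) (use assms(2) in \<open>auto simp: induced_edges_def\<close>)
qed

lemma cross_indicator: "cross E a b (\<lambda>v. of_bool (v \<in> A)) = cut_deg E a b A"
  unfolding cross_def cut_deg_def by (intro sum.cong) auto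

text \<open>Even labels inside \<open>A\<close> and odd ones outside keep the refined classes apart
  from the others.\<close>

definition splice_partition :: "'v set \<Rightarrow> ('v \<Rightarrow> nat) \<Rightarrow> ('v \<Rightarrow> nat) \<Rightarrow> 'v \<Rightarrow> nat" where
  "splice_partition A q f x = (if x \<in> A then 2 * q x else 2 * f x + 1)"

lemma card_splice_partition:
  assumes "finite V" "A \<subseteq> V"
  shows "card (splice_partition A q f ` V) = card (q ` A) + card (f ` (V - A))"
proof -
  have "splice_partition A q f ` V = (\<lambda>n. 2 * n) ` q ` A \<union> (\<lambda>n. 2 * n + 1) ` f ` (V - A)"
    using assms(2) by (auto simp: splice_partition_def image_iff)
  moreover have "(\<lambda>n. 2 * n) ` q ` A \<inter> (\<lambda>n. 2 * n + 1) ` f ` (V - A) = {}"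
    by (auto, presburger)
  moreover have "card ((\<lambda>n. 2 * n) ` q ` A) = card (q ` A)"
    "card ((\<lambda>n. 2 * n + 1) ` f ` (V - A)) = card (f ` (V - A))"
    by (intro card_image; simp add: inj_on_def)+
  ultimately show ?thesis
    using assms finite_subset[OF assms(2,1)] by (simp add: card_Un_disjoint)
qed

text \<open>The last assumption makes \<open>A\<close> a class of \<open>f\<close>. Edges inside
  \<open>A\<close> then do not cross \<open>f\<close>, so no edge is counted twice.\<close>

lemma cross_splice_partition:
  assumes "finite E" and E: "\<And>e. e \<in> E \<Longrightarrow> a e \<in> V \<and> b e \<in> V"
    and f: "\<And>x y. x \<in> V \<Longrightarrow> y \<in> V \<Longrightarrow> x \<in> A \<Longrightarrow> f x = f y \<longleftrightarrow> y \<in> A"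
  shows "cross E a b (splice_partition A q f) = cross (induced_edges E a b A) a b q + cross E a b f"
proof -
  have "cross (induced_edges E a b A) a b q =
      (\<Sum>e\<in>E. of_bool (e \<in> induced_edges E a b A \<and> q (a e) \<noteq> q (b e)))"
    unfolding cross_def using assms(1)
    by (intro sum.mono_neutral_cong_left) (auto simp: induced_edges_def)
  moreover have "of_bool (splice_partition A q f (a e) \<noteq> splice_partition A q f (b e)) =
      of_bool (e \<in> induced_edges E a b A \<and> q (a e) \<noteq> q (b e)) + (of_bool (f (a e) \<noteq> f (b e)) :: nat)"
    if e: "e \<in> E" for e
  proof -
    have parity: "2 * u \<noteq> Suc (2 * v)" "Suc (2 * v) \<noteq> 2 * u" for u v :: nat by presburger+
    show ?thesis
      using E[OF e] f[of "a e" "b e"] f[of "b e" "a e"] e parity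
      by (cases "a e \<in> A"; cases "b e \<in> A") (auto simp: splice_partition_def induced_edges_def)
  qed
  ultimately show ?thesis unfolding cross_def by (simp add: sum.distrib del: sum_of_bool_eq)
qed

section \<open>A minimal dense counterexample: small cuts and tight partitions\<close>

locale critical_dense =
  fixes V :: "'v set" and E :: "'e set" and a b :: "'e \<Rightarrow> 'v" and g :: "'v \<Rightarrow> 3"
  assumes dense: "dense_graph V E a b" and sum_g: "sum g V = 0"
    and not_realizable: "\<not> realizable V E a b g"
    and smaller: "\<And>(V' :: 'v set) (E' :: 'e set) a' b' g'. dense_graph V' E' a' b' \<Longrightarrow>
      card V' + card E' < card V + card E \<Longrightarrow> sum g' V' = 0 \<Longrightarrow> realizable V' E' a' b' g'"
begin

lemma ref_graph: "ref_graph V E a b" and V_ne: "V \<noteq> {}"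
  and partition: "4 * card (f ` V) \<le> cross E a b f + 7"
  and cut2: "A \<noteq> {} \<Longrightarrow> A \<subset> V \<Longrightarrow> 2 \<le> cut_deg E a b A"
  using dense by (auto simp: dense_graph_def)

sublocale loopless V E a b
proof
  show "ref_graph V E a b" by (rule ref_graph)
  fix e assume e: "e \<in> E"
  have finE: "finite E" using ref_graph by (simp add: ref_graph_def)
  show "a e \<noteq> b e"
  proof
    assume eq: "a e = b e"
    have "cross E a b f = cross (E - {e}) a b f" for f
      unfolding cross_def using e finE eq by (simp add: sum.remove[of E e] del: sum_of_bool_eq)
    moreover have "cut_deg E a b A = cut_deg (E - {e}) a b A" for A
      using cut_deg_remove[OF finE e, of a b A] eq by simp
    ultimately have "dense_graph V (E - {e}) a b"
      using dense by (auto simp: dense_graph_def ref_graph_def)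
    moreover have "card (E - {e}) < card E" using e finE by (meson card_Diff1_less)
    ultimately have "realizable V (E - {e}) a b g" using sum_g by (intro smaller) auto
    then have "realizable V E a b g"
      using realizable_delete[OF finE e, of "a e" a b 1 V g] eq by (simp add: far_def)
    then show False using not_realizable by blast
  qed
qed

lemma realizable_collapse:
  assumes "A \<subseteq> V" "p \<in> A" "2 \<le> card A"
  shows "realizable (collapse A p ` V) E (collapse A p \<circ> a) (collapse A p \<circ> b)
    (push (collapse A p) V g)"
proof (rule smaller[OF dense_push[OF dense]])
  show "card (collapse A p ` V) + card E < card V + card E"
    using card_collapse[OF finV assms] by simp
  have "{x\<in>V. collapse A p x \<in> collapse A p ` V} = V" by auto
  then show "sum (push (collapse A p) V g) (collapse A p ` V) = 0"
    using sum_push[OF finV order_refl, of "collapse A p" g] sum_g by simp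
qed

lemma no_parallel:
  assumes e: "e1 \<in> E" "e2 \<in> E" "e1 \<noteq> e2" and xy: "{a e1, b e1} = {x, y}" "{a e2, b e2} = {x, y}"
  shows False
proof -
  have "x \<noteq> y" using no_loop[OF e(1)] xy(1) by auto
  moreover have "{x, y} \<subseteq> V" unfolding xy(1)[symmetric] using ends_in e by simp
  ultimately have "realizable V E a b g"
    by (intro realizable_contract_parallel[OF ref_graph e _ xy realizable_collapse]) auto
  then show False using not_realizable by blast
qed

lemma not_dense_induced:
  assumes A: "A \<subset> V" "2 \<le> card A"
  shows "\<not> dense_graph A (induced_edges E a b A) a b"
proof
  assume d: "dense_graph A (induced_edges E a b A) a b"
  obtain p where p: "p \<in> A" using A by fastforce
  have "card (induced_edges E a b A) \<le> card E"
    using finE by (intro card_mono) (auto simp: induced_edges_def)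
  then have "card A + card (induced_edges E a b A) < card V + card E"
    using psubset_card_mono[OF finV A(1)] by linarith
  then have "realizable V E a b g"
    using A p by (intro realizable_contract[OF ref_graph _ p realizable_collapse] smaller[OF d]) auto
  then show False using not_realizable by blast
qed

lemma induced_partition:
  assumes A: "A \<subset> V" "2 \<le> card A"
    and cut: "\<And>B. B \<noteq> {} \<Longrightarrow> B \<subset> A \<Longrightarrow> 2 \<le> cut_deg (induced_edges E a b A) a b B"
  shows "\<exists>q. cross (induced_edges E a b A) a b q + 7 < 4 * card (q ` A)"
proof (rule ccontr)
  assume "\<not> ?thesis"
  then have "dense_graph A (induced_edges E a b A) a b"
    using induced_ref_graph[OF ref_graph] A cut
    by (auto simp: dense_graph_def not_less)
  then show False using not_dense_induced A by blast
qed

text \<open>Were the bound with 6 instead of 7 true for all \<open>q\<close>, two classes would give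
  \<open>8 \<le> cut + 6\<close>, so all cuts would have 2 edges and
  \<open>induced_partition\<close> would apply.\<close>

lemma induced_partition':
  assumes A: "A \<subset> V" "2 \<le> card A"
  shows "\<exists>q. cross (induced_edges E a b A) a b q + 6 < 4 * card (q ` A)"
proof (rule ccontr)
  assume "\<not> ?thesis"
  then have q: "4 * card (q ` A) \<le> cross (induced_edges E a b A) a b q + 6" for q
    by (meson not_less)
  have "2 \<le> cut_deg (induced_edges E a b A) a b B" if B: "B \<noteq> {}" "B \<subset> A" for B
  proof -
    have "(\<lambda>v. of_bool (v \<in> B) :: nat) ` A = {0, 1}" using B by (auto simp: image_iff)
    then show ?thesis using q[of "\<lambda>v. of_bool (v \<in> B)"] by (simp add: cross_indicator)
  qed
  then obtain q' where "cross (induced_edges E a b A) a b q' + 7 < 4 * card (q' ` A)"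
    using induced_partition[OF A] by blast
  then show False using q[of q'] by linarith
qed

text \<open>The complement of \<open>A\<close> is added as one class, which uses up 4 of the
  constant 7.\<close>

lemma cut_partition:
  assumes A: "A \<noteq> {}" "A \<subset> V"
  shows "4 * card (q ` A) \<le> cross (induced_edges E a b A) a b q + cut_deg E a b A + 3"
proof -
  let ?f = "\<lambda>v. of_bool (v \<in> A) :: nat"
  have "?f ` (V - A) = {0}" using A by auto
  then have "card (splice_partition A q ?f ` V) = card (q ` A) + 1"
    using card_splice_partition[OF finV, of A q ?f] A by auto
  moreover have "cross E a b (splice_partition A q ?f) = cross (induced_edges E a b A) a b q + cut_deg E a b A"
    using cross_splice_partition[OF finE, where a = a and b = b and V = V and A = A and f = ?f and q = q]
      ends_in by (simp add: cross_indicator)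
  ultimately show "4 * card (q ` A) \<le> cross (induced_edges E a b A) a b q + cut_deg E a b A + 3"
    using partition[of "splice_partition A q ?f"] by simp
qed

text \<open>Two vertices would be joined by parallel edges. With three, the complement of a single
  vertex has two vertices, so cut bounds for large sets extend to all sets.\<close>

lemma card_V: "3 \<le> card V"
proof (rule ccontr)
  assume "\<not> 3 \<le> card V"
  moreover have "card V \<noteq> 0" using V_ne finV by simp
  ultimately consider "card V = 1" | "card V = 2" by linarith
  then show False
  proof cases
    case 1
    then obtain x where x: "V = {x}" by (auto simp: card_1_singleton_iff)
    then have "E = {}" using ends_in no_loop by blast
    then have "realizable V E a b g"
      using sum_g x by (simp add: realizable_def boundary_def)
    then show False using not_realizable by blast
  next
    case 2
    then obtain x y where xy: "V = {x, y}" "x \<noteq> y" by (auto simp: card_2_iff)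
    then have "{x} \<subset> V" by auto
    then have "2 \<le> card (star x)" using cut2[of "{x}"] card_star[of x] by simp
    then obtain e1 e2 where e: "e1 \<in> star x" "e2 \<in> star x" "e1 \<noteq> e2"
      by (metis card_le_Suc0_iff_eq finE finite_subset not_less_eq_eq numeral_2_eq_2 star_E)
    have "{a e, b e} = {x, y}" if "e \<in> star x" for e
      using star_far[OF that] xy by auto
    from no_parallel[OF star_far(1)[OF e(1)] star_far(1)[OF e(2)] e(3) this[OF e(1)] this[OF e(2)]]
    show False .
  qed
qed

lemma cut4_large:
  assumes A: "A \<subset> V" "2 \<le> card A"
  shows "4 \<le> cut_deg E a b A"
proof (rule ccontr)
  assume n: "\<not> 4 \<le> cut_deg E a b A"
  obtain q where q: "cross (induced_edges E a b A) a b q + 6 < 4 * card (q ` A)"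
    using induced_partition'[OF A] by blast
  have "A \<noteq> {}" using A by auto
  then show False using cut_partition[OF _ A(1), of q] q n by linarith
qed

lemma cut4:
  assumes A: "A \<noteq> {}" "A \<subset> V"
  shows "4 \<le> cut_deg E a b A"
proof (cases "2 \<le> card A")
  case True
  then show ?thesis using cut4_large A by blast
next
  case False
  have fA: "finite A" using A finV finite_subset by blast
  then have "2 \<le> card (V - A)" using card_V False A by (simp add: card_Diff_subset psubset_imp_subset)
  moreover have "V - A \<subset> V" using A by blast
  ultimately have "4 \<le> cut_deg E a b (V - A)" using cut4_large by blast
  then show ?thesis using cut_deg_compl[OF ref_graph] A by auto
qed

text \<open>If at most 4 edges leave \<open>A\<close>, then \<open>4 + 4 \<le> 2 * c + 4\<close> for
  every cut of size \<open>c\<close> inside \<open>A\<close>, which yields the stronger partition of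
  \<open>A\<close>.\<close>

lemma cut5_large:
  assumes A: "A \<subset> V" "2 \<le> card A"
  shows "5 \<le> cut_deg E a b A"
proof (rule ccontr)
  assume n: "\<not> 5 \<le> cut_deg E a b A"
  have A0: "A \<noteq> {}" using A by auto
  have "2 \<le> cut_deg (induced_edges E a b A) a b B" if B: "B \<noteq> {}" "B \<subset> A" for B
  proof -
    have "4 \<le> cut_deg E a b B" "4 \<le> cut_deg E a b (A - B)" using B A by (auto intro!: cut4)
    then show ?thesis using cut_deg_split[OF finE, of B A a b] B n by auto
  qed
  then obtain q where q: "cross (induced_edges E a b A) a b q + 7 < 4 * card (q ` A)"
    using induced_partition[OF A] by blast
  then show False using cut_partition[OF A0 A(1), of q] n by linarith
qed

lemma cut5:
  assumes A: "A \<noteq> {}" "A \<subset> V"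
  shows "5 \<le> cut_deg E a b A"
proof (cases "2 \<le> card A")
  case True
  then show ?thesis using cut5_large A by blast
next
  case False
  have fA: "finite A" using A finV finite_subset by blast
  then have "2 \<le> card (V - A)" using card_V False A by (simp add: card_Diff_subset psubset_imp_subset)
  moreover have "V - A \<subset> V" using A by blast
  ultimately have "5 \<le> cut_deg E a b (V - A)" using cut5_large by blast
  then show ?thesis using cut_deg_compl[OF ref_graph] A by auto
qed

lemma induced_cut3:
  assumes A: "A \<subset> V" "cut_deg E a b A = 5" and B: "B \<noteq> {}" "B \<subset> A"
  shows "3 \<le> cut_deg (induced_edges E a b A) a b B"
proof -
  have "5 \<le> cut_deg E a b B" "5 \<le> cut_deg E a b (A - B)" using B A by (auto intro!: cut5)
  then show ?thesis using cut_deg_split[OF finE, of B A a b] B A by auto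
qed

text \<open>Refining a class with at least two vertices into \<open>k\<close> classes adds
  \<open>4 * (k - 1)\<close> to the left side and at most \<open>4 * k - 7\<close> to the right,
  which a tight bound does not allow.\<close>

lemma partition_not_inj:
  assumes f: "\<not> inj_on f V"
  shows "4 * card (f ` V) \<le> cross E a b f + 6"
proof (rule ccontr)
  assume "\<not> ?thesis"
  then have tight: "4 * card (f ` V) = cross E a b f + 7" using partition[of f] by linarith
  obtain x y where xy: "x \<in> V" "y \<in> V" "x \<noteq> y" "f x = f y" using f by (auto simp: inj_on_def)
  define A where "A = {z\<in>V. f z = f x}"
  have AV: "A \<subseteq> V" "finite A" using finV by (auto simp: A_def)
  have "{x, y} \<subseteq> A" using xy by (auto simp: A_def)
  then have A2: "2 \<le> card A" using card_mono[OF AV(2), of "{x, y}"] xy by simp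
  have "A \<noteq> V"
  proof
    assume "A = V"
    then have "f ` V = {f x}" using xy by (auto simp: A_def)
    then show False using tight by simp
  qed
  then have A: "A \<subset> V" using AV by blast
  obtain q where q: "cross (induced_edges E a b A) a b q + 6 < 4 * card (q ` A)"
    using induced_partition'[OF A A2] by blast
  have "f ` V = insert (f x) (f ` (V - A))" "f x \<notin> f ` (V - A)" using xy by (auto simp: A_def)
  then have "card (f ` V) = Suc (card (f ` (V - A)))" using finV by simp
  then have "card (splice_partition A q f ` V) + 1 = card (q ` A) + card (f ` V)"
    using card_splice_partition[OF finV AV(1), of q f] by simp
  moreover have "cross E a b (splice_partition A q f) = cross (induced_edges E a b A) a b q + cross E a b f"
    by (rule cross_splice_partition[OF finE, where V = V]) (use ends_in in \<open>auto simp: A_def\<close>)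
  ultimately show False using partition[of "splice_partition A q f"] q tight by linarith
qed

lemma cut_partition_not_inj:
  assumes A: "A \<noteq> {}" "A \<subset> V" and inj: "\<not> inj_on q A \<or> 2 \<le> card (V - A)"
  shows "4 * card (q ` A) \<le> cross (induced_edges E a b A) a b q + cut_deg E a b A + 2"
proof -
  let ?f = "\<lambda>v. of_bool (v \<in> A) :: nat"
  have "?f ` (V - A) = {0}" using A by auto
  then have "card (splice_partition A q ?f ` V) = card (q ` A) + 1"
    using card_splice_partition[OF finV, of A q ?f] A by auto
  moreover have "cross E a b (splice_partition A q ?f) = cross (induced_edges E a b A) a b q + cut_deg E a b A"
    using cross_splice_partition[OF finE, where a = a and b = b and V = V and A = A and f = ?f and q = q]
      ends_in by (simp add: cross_indicator)
  moreover have "\<not> inj_on (splice_partition A q ?f) V"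
    using inj
  proof
    assume "\<not> inj_on q A"
    then obtain x y where "x \<in> A" "y \<in> A" "x \<noteq> y" "q x = q y" by (auto simp: inj_on_def)
    then have "x \<in> V" "y \<in> V" "x \<noteq> y" "splice_partition A q ?f x = splice_partition A q ?f y"
      using A by (auto simp: splice_partition_def)
    then show ?thesis by (auto simp: inj_on_def)
  next
    assume "2 \<le> card (V - A)"
    then obtain x y where "x \<in> V - A" "y \<in> V - A" "x \<noteq> y"
      by (metis card_le_Suc0_iff_eq finV finite_Diff not_less_eq_eq numeral_2_eq_2)
    then have "x \<in> V" "y \<in> V" "x \<noteq> y" "splice_partition A q ?f x = splice_partition A q ?f y"
      by (auto simp: splice_partition_def)
    then show ?thesis by (auto simp: inj_on_def)
  qed
  ultimately show ?thesis
    using partition_not_inj[of "splice_partition A q ?f"] by simp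
qed

lemma cut6_large:
  assumes A: "A \<subset> V" "2 \<le> card A" "2 \<le> card (V - A)"
  shows "6 \<le> cut_deg E a b A"
proof (rule ccontr)
  assume n: "\<not> 6 \<le> cut_deg E a b A"
  have A0: "A \<noteq> {}" using A by auto
  have d: "cut_deg E a b A = 5" using n cut5[OF A0 A(1)] by simp
  have "2 \<le> cut_deg (induced_edges E a b A) a b B" if B: "B \<noteq> {}" "B \<subset> A" for B
    using induced_cut3[OF A(1) d B] by simp
  then obtain q where q: "cross (induced_edges E a b A) a b q + 7 < 4 * card (q ` A)"
    using induced_partition[OF A(1,2)] by blast
  then show False using cut_partition_not_inj[OF A0 A(1), of q] A(3) d by simp
qed

text \<open>If all cuts had 6 edges, the graph with no edges at \<open>z\<^sub>0\<close> would be a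
  configuration: even cuts need at most 6 edges, and odd ones, needing at most 7, have 7. A cut of 5
  edges has a single vertex on one side by \<open>cut6_large\<close>.\<close>

lemma ex_degree_5:
  obtains x where "x \<in> V" "card (star x) = 5"
proof -
  have "\<exists>A. A \<noteq> {} \<and> A \<subset> V \<and> cut_deg E a b A < 6"
  proof (rule ccontr)
    assume "\<not> ?thesis"
    then have c: "6 \<le> cut_deg E a b A" if "A \<noteq> {}" "A \<subset> V" for A
      using that not_less by blast
    have "config V E a b g (\<lambda>_. 0) g"
    proof (rule configI)
      fix A assume "A \<noteq> {}" "A \<subset> V"
      then have "6 \<le> cut_deg E a b A" by (rule c)
      then show "4 + tau (tdeg E a b (\<lambda>_. 0) A) (sum g A) \<le> tdeg E a b (\<lambda>_. 0) A"
        by (cases "even (cut_deg E a b A)") (auto simp: tau_def tdeg_def le_Suc_eq elim!: oddE)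
    qed (use ref_graph V_ne sum_g in auto)
    then show False using config_realizable not_realizable by blast
  qed
  then obtain A where A: "A \<noteq> {}" "A \<subset> V" "cut_deg E a b A < 6" by blast
  have fA: "finite A" using A finV finite_subset by blast
  have d: "cut_deg E a b A = 5" using cut5[OF A(1,2)] A(3) by simp
  have "\<not> (2 \<le> card A \<and> 2 \<le> card (V - A))" using cut6_large[OF A(2)] A(3) by auto
  moreover have "card A \<noteq> 0" "card (V - A) \<noteq> 0" using A fA finV by auto
  ultimately have "card A = 1 \<or> card (V - A) = 1" by linarith
  then show thesis
  proof
    assume "card A = 1"
    then obtain x where "A = {x}" by (auto simp: card_1_singleton_iff)
    then show thesis using that[of x] d card_star[of x] A by auto
  next
    assume "card (V - A) = 1"
    then obtain x where "V - A = {x}" by (auto simp: card_1_singleton_iff)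
    then show thesis
      using that[of x] d card_star[of x] A cut_deg_compl[OF ref_graph, of A] by auto
  qed
qed


text \<open>
  Two edges at \<open>x\<close> are lifted and the other three are oriented to meet the prescription at \<open>x\<close>.
  Only the discrete partition can be tight, and it gains the lifted edge.
\<close>

lemma no_degree_5:
  assumes x: "x \<in> V" and card: "card (star x) = 5"
  shows False
proof -
  obtain e1 S1 where S1: "star x = insert e1 S1" "e1 \<notin> S1" "card S1 = 4"
    using card card_Suc_eq[of "star x" 4] by auto
  obtain e2 S2 where S2: "S1 = insert e2 S2" "e2 \<notin> S2" "card S2 = 3"
    using S1 card_Suc_eq[of S1 3] by auto
  then obtain e3 e4 e5 where S3: "S2 = {e3, e4, e5}" "e3 \<noteq> e4" "e3 \<noteq> e5" "e4 \<noteq> e5"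
    unfolding card_3_iff by auto
  have S: "star x = {e1, e2, e3, e4, e5}" using S1 S2 S3 by simp
  have ne: "e1 \<noteq> e2" "e1 \<noteq> e3" "e1 \<noteq> e4" "e1 \<noteq> e5" "e2 \<noteq> e3" "e2 \<noteq> e4" "e2 \<noteq> e5"
    "e3 \<noteq> e4" "e3 \<noteq> e5" "e4 \<noteq> e5" using S1 S2 S3 by auto
  define y1 y2 y3 y4 y5 where y: "y1 = far a b x e1" "y2 = far a b x e2" "y3 = far a b x e3"
    "y4 = far a b x e4" "y5 = far a b x e5"
  have es: "e1 \<in> star x" "e2 \<in> star x" "e3 \<in> star x" "e4 \<in> star x" "e5 \<in> star x" using S by auto
  note f1 = star_far[OF es(1), folded y] and f2 = star_far[OF es(2), folded y]
    and f3 = star_far[OF es(3), folded y] and f4 = star_far[OF es(4), folded y]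
    and f5 = star_far[OF es(5), folded y]
  have y12: "y1 \<noteq> y2"
  proof
    assume "y1 = y2"
    from no_parallel[OF f1(1) f2(1) ne(1) f1(6) f2(6)[folded this]] show False .
  qed
  let ?W = "V - {x}"
  let ?I = "induced_edges E a b ?W"
  let ?E3 = "E - {e3}" and ?E4 = "E - {e3} - {e4}" and ?E5 = "E - {e3} - {e4} - {e5}"
  let ?E' = "E - {e3} - {e4} - {e5} - {e2}" and ?a = "a(e1 := y2)" and ?b = "b(e1 := y1)"
  have I: "?I = E - star x"
    using ends_in by (auto simp: induced_edges_def star_def)
  have E': "?E' = insert e1 ?I" "e1 \<notin> ?I" using S ne f1(1) unfolding I by auto
  have finI: "finite ?I" using finE by (simp add: I)
  have aI: "?a e = a e" "?b e = b e" if "e \<in> ?I" for e using that E'(2) by auto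
  have cross': "cross ?E' ?a ?b q = cross ?I a b q + of_bool (q y1 \<noteq> q y2)" for q
  proof -
    have "cross ?I ?a ?b q = cross ?I a b q"
      unfolding cross_def using aI by (intro sum.cong) auto
    moreover have "cross ?E' ?a ?b q = of_bool (q y2 \<noteq> q y1) + cross ?I ?a ?b q"
      unfolding E'(1) cross_def using E'(2) finI by (simp add: sum.insert del: sum_of_bool_eq)
    ultimately show ?thesis by auto
  qed
  have cut': "cut_deg ?I a b B \<le> cut_deg ?E' ?a ?b B" for B
  proof -
    have "cut_deg ?I ?a ?b B = cut_deg ?I a b B"
      unfolding cut_deg_def using aI by (intro sum.cong) auto
    moreover have "cut_deg ?I ?a ?b B \<le> cut_deg ?E' ?a ?b B"
      unfolding E'(1) cut_deg_def by (rule sum_mono2) (use finI in auto)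
    ultimately show ?thesis by simp
  qed
  have "card ?W \<noteq> 0" using card_V card_Diff_singleton[OF x] by simp
  then have W: "?W \<noteq> {}" "?W \<subset> V" using x by (metis card.empty, blast)
  have dW: "cut_deg E a b ?W = 5"
    using cut_deg_compl[OF ref_graph, of "{x}"] x card card_star by simp
  have dn: "dense_graph ?W ?E' ?a ?b"
    unfolding dense_graph_def
  proof (intro conjI allI impI)
    show "ref_graph ?W ?E' ?a ?b"
      unfolding E'(1) using f1 f2 finI finV by (auto simp: ref_graph_def induced_edges_def)
    show "?W \<noteq> {}" by (rule W)
    show "2 \<le> cut_deg ?E' ?a ?b B" if "B \<noteq> {}" "B \<subset> ?W" for B
      using induced_cut3[OF W(2) dW that] cut'[of B] by simp
    show "4 * card (q ` ?W) \<le> cross ?E' ?a ?b q + 7" for q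
    proof (cases "inj_on q ?W")
      case True
      then have "q y1 \<noteq> q y2" using f1 f2 y12 by (auto simp: inj_on_def)
      then show ?thesis using cut_partition[OF W, of q] dW cross'[of q] by simp
    next
      case False
      then show ?thesis using cut_partition_not_inj[OF W, of q] dW cross'[of q] by simp
    qed
  qed
  have cd: "card ?W + card ?E' < card V + card E"
  proof -
    have "card ?W < card V" using x finV by (meson card_Diff1_less)
    moreover have "card ?E' \<le> card E" using finE by (intro card_mono) auto
    ultimately show ?thesis by simp
  qed
  \<comment> \<open>Sums of three nonzero values cover all residues modulo 3, so no condition on
    \<open>g x\<close> arises.\<close>
  obtain c3 c4 c5 :: 3 where c: "c3 \<noteq> 0" "c4 \<noteq> 0" "c5 \<noteq> 0" "g x = c3 + c4 + c5"
  proof (cases "g x" rule: z3_cases)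
    case 1 then show ?thesis using that[of 1 1 1] by simp
  next
    case 2 then show ?thesis using that[of 1 1 "-1"] by simp
  next
    case 3 then show ?thesis using that[of "-1" "-1" 1] by simp
  qed
  let ?g3 = "\<lambda>v. g v - c3 * (of_bool (x = v) - of_bool (y3 = v))"
  let ?g4 = "\<lambda>v. ?g3 v - c4 * (of_bool (x = v) - of_bool (y4 = v))"
  let ?g5 = "\<lambda>v. ?g4 v - c5 * (of_bool (x = v) - of_bool (y5 = v))"
  have gx: "?g5 x = 0" using c f3(4) f4(4) f5(4) by simp
  have "sum ?g5 V = sum ?g4 V" using x f5(3) sum_transfer[OF finV, of ?g4 c5 x y5] by simp
  also have "\<dots> = sum ?g3 V" using x f4(3) sum_transfer[OF finV, of ?g3 c4 x y4] by simp
  also have "\<dots> = 0" using x f3(3) sum_transfer[OF finV, of g c3 x y3] sum_g by simp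
  finally have "sum ?g5 ?W = 0" using gx x finV by (simp add: sum.remove[of V x])
  with dn cd have r: "realizable ?W ?E' ?a ?b ?g5" by (rule smaller)
  have "realizable V ?E' ?a ?b ?g5"
  proof (rule realizable_remove_vertex[OF _ gx r])
    show "\<forall>e\<in>?E'. ?a e \<noteq> x \<and> ?b e \<noteq> x"
      unfolding E'(1) using f1(4) f2(4) by (auto simp: induced_edges_def)
  qed
  then have r5: "realizable V ?E5 a b ?g5"
    using realizable_lift[where a=a and b=b and E="?E5" and ?e1.0=e1 and ?e2.0=e2 and x=x
      and V=V and g = ?g5, folded y] ne f1(1,2) f2(1,2) finE by auto
  have r4: "realizable V ?E4 a b ?g4"
    by (rule realizable_delete[where a=a and b=b and E="?E4" and x=x, OF _ _ f5(2) c(3), folded y, OF _ _ r5])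
      (use ne f5(1) finE in auto)
  have r3: "realizable V ?E3 a b ?g3"
    by (rule realizable_delete[where a=a and b=b and E="?E3" and x=x, OF _ _ f4(2) c(2), folded y, OF _ _ r4])
      (use ne f4(1) finE in auto)
  have "realizable V E a b g"
    by (rule realizable_delete[where a=a and b=b and x=x, OF finE f3(1,2) c(1), folded y, OF r3])
  then show False using not_realizable by blast
qed

end

theorem dense_realizable:
  fixes V :: "'v set" and E :: "'e set"
  assumes "dense_graph V E a b" "sum g V = 0"
  shows "realizable V E a b g"
  using assms
proof (induction "card V + card E" arbitrary: V E a b g rule: less_induct)
  case (less V E a b g)
  show ?case
  proof (rule ccontr)
    assume "\<not> realizable V E a b g"
    then interpret critical_dense V E a b g
      using less by unfold_locales blast+
    show False using ex_degree_5 no_degree_5 by metis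
  qed
qed

section \<open>Multigraphs and spanning trees\<close>

definition reference :: "('v, 'e) multigraph \<Rightarrow> ('e \<Rightarrow> 'v) \<Rightarrow> ('e \<Rightarrow> 'v) \<Rightarrow> bool" where
  "reference G a b \<longleftrightarrow> (\<forall>e\<in>edges G. ends G e = {a e, b e} \<and> a e \<noteq> b e)"

lemma ex_reference:
  assumes "wf_multigraph G"
  obtains a b where "reference G a b"
proof -
  have "\<forall>e\<in>edges G. \<exists>p. ends G e = {fst p, snd p} \<and> fst p \<noteq> snd p"
    using assms by (auto simp: wf_multigraph_def card_2_iff)
  then obtain p where "\<forall>e\<in>edges G. ends G e = {fst (p e), snd (p e)} \<and> fst (p e) \<noteq> snd (p e)"
    by metis
  then show thesis using that[of "fst \<circ> p" "snd \<circ> p"] by (simp add: reference_def)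
qed

lemma reference_ref_graph:
  assumes "wf_multigraph G" "reference G a b"
  shows "ref_graph (vertices G) (edges G) a b"
  using assms by (auto simp: wf_multigraph_def reference_def ref_graph_def)

lemma net_outdegree_boundary:
  assumes "finite (arcs D)"
  shows "net_outdegree D v = boundary (arcs D) (tail D) (head D) (\<lambda>_. 1) v"
proof -
  have c: "of_nat (card {e\<in>arcs D. P e}) = (\<Sum>e\<in>arcs D. of_bool (P e) :: 3)" for P
    using assms by (simp add: Int_def)
  show ?thesis
    unfolding net_outdegree_def out_degree_def in_degree_def out_arcs_def in_arcs_def boundary_def
    by (simp only: c mult_1_left sum_subtractf)
qed

lemma orientation_boundary:
  assumes S: "finite S" and s: "\<forall>e\<in>S. s e \<noteq> 0"
    and D: "arcs D = S" "\<And>e. e \<in> S \<Longrightarrow> tail D e = (if s e = 1 then a e else b e)"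
      "\<And>e. e \<in> S \<Longrightarrow> head D e = (if s e = 1 then b e else a e)"
  shows "net_outdegree D v = boundary S a b s v"
proof -
  have "boundary S (tail D) (head D) (\<lambda>_. 1) v = boundary S a b s v"
    unfolding boundary_def
  proof (intro sum.cong refl)
    fix e assume e: "e \<in> S"
    have "s e = 1 \<or> s e = -1" using s e by (cases "s e" rule: z3_cases) auto
    then show "1 * (of_bool (tail D e = v) - of_bool (head D e = v)) =
        s e * (of_bool (a e = v) - of_bool (b e = v))"
      using D(2,3)[OF e] by auto
  qed
  then show ?thesis using net_outdegree_boundary[of D] S D(1) by simp
qed

lemma realizable_beta_orientation:
  assumes G: "wf_multigraph G" "reference G a b"
    and r: "realizable (vertices G) (edges G) a b \<beta>"
  shows "\<exists>D. beta_orientation G \<beta> D"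
proof -
  obtain s where s: "\<forall>e\<in>edges G. s e \<noteq> 0" "\<forall>v\<in>vertices G. boundary (edges G) a b s v = \<beta> v"
    using r unfolding realizable_def by blast
  define D where "D = \<lparr>verts = vertices G, arcs = edges G,
    tail = \<lambda>e. if s e = 1 then a e else b e, head = \<lambda>e. if s e = 1 then b e else a e\<rparr>"
  have "net_outdegree D v = boundary (edges G) a b s v" for v
    by (rule orientation_boundary) (use G s in \<open>auto simp: D_def wf_multigraph_def\<close>)
  then have "beta_orientation G \<beta> D"
    using s G by (auto simp: beta_orientation_def orientation_of_def D_def reference_def)
  then show ?thesis by blast
qed

text \<open>
  A crossing edge is removed from the count by merging the two labels at its ends.
\<close>

lemma connected_crossing:
  assumes "connected_graph H" "finite (edges H)" "\<forall>e\<in>edges H. card (ends H e) = 2"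
  shows "card (f ` vertices H) \<le> card {e\<in>edges H. card (f ` ends H e) \<noteq> 1} + 1"
proof (induction "card {e\<in>edges H. card (f ` ends H e) \<noteq> 1}" arbitrary: f rule: less_induct)
  case less
  let ?C = "\<lambda>f. {e\<in>edges H. card (f ` ends H e) \<noteq> 1}"
  have fin: "finite (?C f)" for f :: "'a \<Rightarrow> 'c" using assms(2) by simp
  show ?case
  proof (cases "?C f = {}")
    case True
    have step: "f u = f v" if uv: "(u, v) \<in> adjacency H" for u v
    proof -
      obtain e where e: "e \<in> edges H" "ends H e = {u, v}" using uv by (auto simp: adjacency_def)
      then have "card (f ` {u, v}) = 1" using True by auto
      then show ?thesis by (auto simp: card_1_singleton_iff)
    qed
    have path: "f u = f v" if "(u, v) \<in> (adjacency H)\<^sup>*" for u v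
      using that by induction (auto dest: step)
    obtain u where u: "u \<in> vertices H" using assms(1) by (auto simp: connected_graph_def)
    have "f ` vertices H \<subseteq> {f u}"
      using assms(1) u path unfolding connected_graph_def by (metis image_subsetI singletonI)
    then have "card (f ` vertices H) \<le> 1" using card_mono[of "{f u}"] by fastforce
    then show ?thesis by simp
  next
    case False
    then obtain e where e: "e \<in> edges H" "card (f ` ends H e) \<noteq> 1" by blast
    then obtain u v where uv: "ends H e = {u, v}" "f u \<noteq> f v"
      using assms(3) by (fastforce simp: card_2_iff)
    define k where "k y = (if y = f u then f v else y)" for y
    define h where "h x = k (f x)" for x
    have im: "card (h ` S) = 1" if S: "card (f ` S) = 1" for S
    proof -
      obtain y where "f ` S = {y}" using S by (auto simp: card_1_singleton_iff)
      then have "k ` f ` S = {k y}" by simp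
      then have "h ` S = {k y}" unfolding h_def by (simp add: image_image)
      then show ?thesis by simp
    qed
    have "h ` ends H e = {f v}" using uv by (auto simp: h_def k_def)
    then have "e \<notin> ?C h" by simp
    moreover have "?C h \<subseteq> ?C f" using im by auto
    ultimately have "?C h \<subset> ?C f" using e by blast
    then have lt: "card (?C h) < card (?C f)" by (rule psubset_card_mono[OF fin])
    have "card (h ` vertices H) \<le> card (?C h) + 1" by (rule less[OF lt])
    moreover have "card (f ` vertices H) \<le> card (h ` vertices H) + 1"
    proof (cases "finite (f ` vertices H)")
      case True
      have "f ` vertices H \<subseteq> insert (f u) (h ` vertices H)" by (auto simp: h_def k_def)
      moreover have "h ` vertices H = k ` f ` vertices H" by (simp add: h_def image_image)
      then have fh: "finite (h ` vertices H)" using True by simp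
      ultimately have "card (f ` vertices H) \<le> card (insert (f u) (h ` vertices H))"
        by (intro card_mono) auto
      also have "\<dots> \<le> card (h ` vertices H) + 1" using fh by (simp add: card_insert_if)
      finally show ?thesis .
    qed simp
    ultimately show ?thesis using lt by linarith
  qed
qed

text \<open>Each tree is connected and so has at least one crossing edge less than the number of
  classes; disjointness lets these counts be added.\<close>

lemma disjoint_spanning_trees_partition:
  assumes G: "finite (edges G)" "\<forall>e\<in>edges G. card (ends G e) = 2"
    and d: "disjoint_spanning_trees G k"
  shows "k * card (f ` vertices G) \<le> card {e\<in>edges G. card (f ` ends G e) \<noteq> 1} + k"
proof -
  let ?C = "{e\<in>edges G. card (f ` ends G e) \<noteq> 1}"
  obtain T where T: "\<And>i. i < k \<Longrightarrow> spanning_tree G (T i)"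
    "\<And>i j. i < k \<Longrightarrow> j < k \<Longrightarrow> i \<noteq> j \<Longrightarrow> T i \<inter> T j = {}"
    using d unfolding disjoint_spanning_trees_def by blast
  have "card (f ` vertices G) \<le> card (?C \<inter> T i) + 1" if i: "i < k" for i
  proof -
    have TE: "T i \<subseteq> edges G" "connected_graph (G\<lparr>edges := T i\<rparr>)"
      using T(1)[OF i] by (auto simp: spanning_tree_def tree_def)
    have "{e\<in>T i. card (f ` ends G e) \<noteq> 1} = ?C \<inter> T i" using TE by auto
    moreover have "finite (T i)" "\<forall>e\<in>T i. card (ends G e) = 2"
      using TE(1) G finite_subset by blast+
    ultimately show ?thesis
      using connected_crossing[OF TE(2), of f] by simp
  qed
  then have "(\<Sum>i<k. card (f ` vertices G)) \<le> (\<Sum>i<k. card (?C \<inter> T i) + 1)"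
    by (intro sum_mono) simp
  also have "\<dots> = (\<Sum>i<k. card (?C \<inter> T i)) + k" by (simp only: sum.distrib) simp
  also have "(\<Sum>i<k. card (?C \<inter> T i)) = card (\<Union>i<k. ?C \<inter> T i)"
    by (rule card_UN_disjoint[symmetric]) (use G T(2) in auto)
  also have "\<dots> \<le> card ?C" by (rule card_mono) (use G in auto)
  finally show ?thesis by simp
qed

text \<open>In the worst case every added edge crosses, which accounts for the term
  \<open>n\<close>.\<close>

lemma deficit_partition:
  assumes G: "wf_multigraph G" "reference G a b" and def: "spanning_tree_deficit G k \<le> enat n"
  shows "k * card (f ` vertices G) \<le> cross (edges G) a b f + n + k"
proof -
  let ?A = "{ps. (\<forall>p \<in> set ps. p \<subseteq> vertices G \<and> card p = 2) \<and> disjoint_spanning_trees (add_edges G ps) k}"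
  have "\<exists>ps\<in>?A. length ps \<le> n"
  proof (rule ccontr)
    assume "\<not> ?thesis"
    then have "enat (Suc n) \<le> spanning_tree_deficit G k"
      unfolding spanning_tree_deficit_def by (intro INF_greatest) (auto simp: not_le Suc_le_eq)
    then have "enat (Suc n) \<le> enat n" using def by (rule order_trans)
    then show False by simp
  qed
  then obtain ps where ps: "\<forall>p \<in> set ps. p \<subseteq> vertices G \<and> card p = 2"
    "disjoint_spanning_trees (add_edges G ps) k" "length ps \<le> n" by blast
  let ?K = "add_edges G ps"
  have K: "finite (edges ?K)" "\<forall>e\<in>edges ?K. card (ends ?K e) = 2"
    using G(1) ps(1) by (auto simp: wf_multigraph_def add_edges_def)
  let ?C = "{e\<in>edges G. f (a e) \<noteq> f (b e)}"
  have finG: "finite (edges G)" using G by (simp add: wf_multigraph_def)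
  have "{e\<in>edges ?K. card (f ` ends ?K e) \<noteq> 1} \<subseteq> Inl ` ?C \<union> Inr ` {..<length ps}"
  proof
    fix e assume e: "e \<in> {e\<in>edges ?K. card (f ` ends ?K e) \<noteq> 1}"
    show "e \<in> Inl ` ?C \<union> Inr ` {..<length ps}"
    proof (cases e)
      case (Inl e')
      then have "e' \<in> edges G" "card (f ` {a e', b e'}) \<noteq> 1"
        using e G(2) by (auto simp: add_edges_def reference_def)
      then show ?thesis using Inl by auto
    next
      case (Inr i)
      then show ?thesis using e by (auto simp: add_edges_def)
    qed
  qed
  then have "card {e\<in>edges ?K. card (f ` ends ?K e) \<noteq> 1} \<le>
      card (Inl ` ?C \<union> Inr ` {..<length ps} :: ('b + nat) set)"
    by (rule card_mono[rotated]) (use finG in auto)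
  also have "\<dots> \<le> card (Inl ` ?C :: ('b + nat) set) + card (Inr ` {..<length ps} :: ('b + nat) set)"
    by (rule card_Un_le)
  also have "\<dots> = card ?C + length ps" by (simp add: card_image)
  also have "card ?C = cross (edges G) a b f" using finG by (simp add: cross_def Int_def)
  finally have "card {e\<in>edges ?K. card (f ` ends ?K e) \<noteq> 1} \<le> cross (edges G) a b f + n"
    using ps(3) by simp
  moreover have "vertices ?K = vertices G" by (simp add: add_edges_def)
  ultimately show ?thesis
    using disjoint_spanning_trees_partition[OF K ps(2), of f] by simp
qed

section \<open>Edge-connectivity in terms of cuts\<close>

lemma edge_connectivity_ge_cut:
  assumes G: "wf_multigraph G" "reference G a b" and ec: "enat k \<le> edge_connectivity G"
    and A: "A \<noteq> {}" "A \<subset> vertices G"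
  shows "k \<le> cut_deg (edges G) a b A"
proof -
  let ?S = "{e\<in>edges G. (a e \<in> A) \<noteq> (b e \<in> A)}"
  obtain u v where uv: "u \<in> A" "v \<in> vertices G" "v \<notin> A" using A by blast
  have stay: "y \<in> A" if "(x, y) \<in> (adjacency (delete_edges G ?S))\<^sup>*" "x \<in> A" for x y
    using that
  proof induction
    case (step y z)
    then obtain e where "e \<in> edges G - ?S" "ends G e = {y, z}"
      by (auto simp: adjacency_def delete_edges_def)
    then show ?case using G(2) step by (auto simp: reference_def doubleton_eq_iff)
  qed
  have "\<not> connected_graph (delete_edges G ?S)"
  proof
    assume "connected_graph (delete_edges G ?S)"
    moreover have "vertices (delete_edges G ?S) = vertices G" by (simp add: delete_edges_def)
    moreover have "u \<in> vertices G" using uv A by blast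
    ultimately have "(u, v) \<in> (adjacency (delete_edges G ?S))\<^sup>*"
      using uv(2) unfolding connected_graph_def by simp
    then show False using stay uv by blast
  qed
  then have "edge_connectivity G \<le> enat (card ?S)"
    unfolding edge_connectivity_def by (intro INF_lower) auto
  then have "enat k \<le> enat (card ?S)" using ec by (rule order_trans[rotated])
  moreover have "card ?S = cut_deg (edges G) a b A"
    using G(1) by (simp add: cut_deg_def wf_multigraph_def Int_def)
  ultimately show ?thesis by simp
qed

text \<open>The set of vertices reachable from some \<open>u\<close> after deleting \<open>S\<close>
  can be left only through \<open>S\<close>.\<close>

lemma disconnected_cut:
  assumes G: "wf_multigraph G" "reference G a b" and S: "S \<subseteq> edges G" "\<not> connected_graph (delete_edges G S)"
  obtains A where "A \<noteq> {}" "A \<subset> vertices G" "cut_deg (edges G) a b A \<le> card S"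
proof -
  let ?R = "(adjacency (delete_edges G S))\<^sup>*"
  have "vertices G \<noteq> {}" using G by (simp add: wf_multigraph_def)
  then obtain u v where uv: "u \<in> vertices G" "v \<in> vertices G" "(u, v) \<notin> ?R"
    using S(2) by (auto simp: connected_graph_def delete_edges_def)
  define A where "A = {x\<in>vertices G. (u, x) \<in> ?R}"
  have "(a e \<in> A) = (b e \<in> A)" if e: "e \<in> edges G - S" for e
  proof -
    have "(a e, b e) \<in> adjacency (delete_edges G S)" "(b e, a e) \<in> adjacency (delete_edges G S)"
      using e G(2) by (auto simp: adjacency_def delete_edges_def reference_def)
    then show ?thesis
      using e reference_ref_graph[OF G] by (auto simp: A_def ref_graph_def intro: rtrancl_into_rtrancl)
  qed
  then have "{e\<in>edges G. (a e \<in> A) \<noteq> (b e \<in> A)} \<subseteq> S" by blast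
  moreover have fin: "finite (edges G)" using G by (simp add: wf_multigraph_def)
  then have "finite S" using S(1) finite_subset by blast
  ultimately have "card {e\<in>edges G. (a e \<in> A) \<noteq> (b e \<in> A)} \<le> card S" by (intro card_mono)
  then have "cut_deg (edges G) a b A \<le> card S"
    using fin by (simp add: cut_deg_def Int_def)
  moreover have "A \<noteq> {}" "A \<subset> vertices G" using uv by (auto simp: A_def)
  ultimately show thesis using that by blast
qed

text \<open>For the zero prescription the net flow out of \<open>A\<close> is 0 modulo 3, but a
  single edge carries 1 or -1.\<close>

lemma Z3_connected_no_single_cut:
  assumes G: "wf_multigraph G" "reference G a b" and Z: "Z3_connected G" and A: "A \<subseteq> vertices G"
  shows "cut_deg (edges G) a b A \<noteq> 1"
proof
  assume one: "cut_deg (edges G) a b A = 1"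
  have "zero_sum G (\<lambda>_. 0)" by (simp add: zero_sum_def)
  then obtain D where D: "beta_orientation G (\<lambda>_. 0) D" using Z unfolding Z3_connected_def by blast
  have fin: "finite (edges G)" "finite A" using G A finite_subset by (auto simp: wf_multigraph_def)
  have arcs: "arcs D = edges G" using D by (auto simp: beta_orientation_def orientation_of_def)
  have "\<exists>e\<in>edges G. of_bool ((a e \<in> A) \<noteq> (b e \<in> A)) = (1 :: nat) \<and>
      (\<forall>e'\<in>edges G. e' \<noteq> e \<longrightarrow> of_bool ((a e' \<in> A) \<noteq> (b e' \<in> A)) = (0 :: nat))"
    by (rule sum_nat_eq_1[OF fin(1)]) (use one in \<open>simp only: cut_deg_def\<close>)
  then obtain e where e: "e \<in> edges G" "(a e \<in> A) \<noteq> (b e \<in> A)"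
    "\<And>e'. e' \<in> edges G \<Longrightarrow> e' \<noteq> e \<Longrightarrow> (a e' \<in> A) = (b e' \<in> A)"
    by (auto simp: of_bool_def split: if_splits)
  have TH: "{tail D e, head D e} = {a e, b e}" if "e \<in> edges G" for e
    using D G(2) that by (auto simp: beta_orientation_def orientation_of_def reference_def)
  let ?t = "\<lambda>e. 1 * (of_bool (tail D e \<in> A) - of_bool (head D e \<in> A)) :: 3"
  have "net_outdegree D v = 0" if "v \<in> A" for v
    using D A that by (auto simp: beta_orientation_def)
  then have "0 = (\<Sum>v\<in>A. net_outdegree D v)" by simp
  also have "\<dots> = (\<Sum>e\<in>edges G. ?t e)"
    using net_outdegree_boundary[of D] fin arcs sum_boundary[OF fin(2), of "edges G" "tail D" "head D" "\<lambda>_. 1"]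
    by simp
  also have "\<dots> = ?t e + (\<Sum>e\<in>edges G - {e}. ?t e)" using fin(1) e(1) by (rule sum.remove)
  also have "(\<Sum>e\<in>edges G - {e}. ?t e) = 0"
  proof (rule sum.neutral, rule ballI)
    fix e' assume "e' \<in> edges G - {e}"
    then show "?t e' = 0" using TH[of e'] e(3)[of e'] by (auto simp: doubleton_eq_iff)
  qed
  finally show False using TH[OF e(1)] e(2) by (auto simp: doubleton_eq_iff)
qed

lemma edge_connectivity_ge_2I:
  assumes "wf_multigraph G" "reference G a b"
    and "\<And>A. A \<noteq> {} \<Longrightarrow> A \<subset> vertices G \<Longrightarrow> 2 \<le> cut_deg (edges G) a b A"
  shows "2 \<le> edge_connectivity G"
  unfolding edge_connectivity_def
proof (rule INF_greatest)
  fix S assume "S \<in> {S. S \<subseteq> edges G \<and> \<not> connected_graph (delete_edges G S)}"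
  then obtain A where "A \<noteq> {}" "A \<subset> vertices G" "cut_deg (edges G) a b A \<le> card S"
    using disconnected_cut[OF assms(1,2)] by blast
  then have "2 \<le> card S" using assms(3)[of A] by simp
  then show "2 \<le> enat (card S)" by (simp add: numeral_eq_enat)
qed

section \<open>The two statements for multigraphs\<close>

lemma dense_multigraph_realizable:
  assumes G: "wf_multigraph G" "reference G a b"
    and "\<And>f. 4 * card (f ` vertices G) \<le> cross (edges G) a b f + 7"
    and "2 \<le> edge_connectivity G"
    and "(\<Sum>v\<in>vertices G. g v) = 0"
  shows "realizable (vertices G) (edges G) a b g"
proof (rule dense_realizable)
  show "dense_graph (vertices G) (edges G) a b"
    using assms reference_ref_graph[OF G] edge_connectivity_ge_cut[OF G, of 2]
    by (auto simp: dense_graph_def wf_multigraph_def numeral_eq_enat)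
qed fact

lemma Z3_extendable_at_low_degree:
  assumes G: "wf_multigraph G" and def: "spanning_tree_deficit G 4 = 0"
    and v: "v \<in> vertices G" "vertex_degree G v \<le> 7"
    and ec: "2 \<le> edge_connectivity (delete_vertex G v)"
  shows "Z3_extendable_at G v"
proof -
  obtain a b where R: "reference G a b" using ex_reference[OF G] by blast
  have RG: "ref_graph (vertices G) (edges G) a b" by (rule reference_ref_graph[OF G R])
  let ?H = "delete_vertex G v" and ?W = "vertices G - {v}" and ?S = "incident_edges G v"
  have H: "vertices ?H = ?W" "edges ?H = edges G - ?S" "ends ?H = ends G"
    by (simp_all add: delete_vertex_def)
  have fin: "finite (vertices G)" "finite (edges G)" using G by (auto simp: wf_multigraph_def)
  have SE: "?S \<subseteq> edges G" by (auto simp: incident_edges_def)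
  have S: "e \<in> ?S \<longleftrightarrow> a e = v \<or> b e = v" if "e \<in> edges G" for e
    using R that by (auto simp: incident_edges_def reference_def)
  have I: "edges G - ?S = induced_edges (edges G) a b ?W"
    using S RG by (auto simp: induced_edges_def ref_graph_def)
  \<comment> \<open>A graph without vertices counts as disconnected, so its edge-connectivity would
    be 0.\<close>
  have W: "?W \<noteq> {}"
  proof
    assume "?W = {}"
    then have "\<not> connected_graph (delete_edges ?H {})" by (simp add: connected_graph_def delete_edges_def H)
    then have "edge_connectivity ?H \<le> enat 0"
      unfolding edge_connectivity_def by (intro INF_lower2[of "{}"]) auto
    then have "2 \<le> enat 0" using ec by (rule order_trans[rotated])
    then show False by (simp add: numeral_eq_enat)
  qed
  have GH: "wf_multigraph ?H"
    using G W by (auto simp: wf_multigraph_def H incident_edges_def)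
  have RH: "reference ?H a b" using R by (auto simp: reference_def H)
  have part: "4 * card (q ` vertices ?H) \<le> cross (edges ?H) a b q + 7" for q
  proof -
    let ?f = "\<lambda>x. of_bool (x \<in> ?W) :: nat"
    have "vertices G - ?W = {v}" using v by auto
    then have "card (splice_partition ?W q ?f ` vertices G) = card (q ` ?W) + 1"
      using card_splice_partition[OF fin(1), of ?W q ?f] by auto
    moreover have "cross (edges G) a b (splice_partition ?W q ?f) =
        cross (induced_edges (edges G) a b ?W) a b q + cross (edges G) a b ?f"
      by (rule cross_splice_partition[OF fin(2), where V = "vertices G"])
        (use RG in \<open>auto simp: ref_graph_def\<close>)
    then have "cross (edges G) a b (splice_partition ?W q ?f) = cross (edges ?H) a b q + cut_deg (edges G) a b ?W"
      by (simp only: cross_indicator H I)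
    moreover have "cut_deg (edges G) a b ?W \<le> 7"
    proof -
      have "cut_deg (edges G) a b ?W = cut_deg (edges G) a b {v}"
        using cut_deg_compl[OF RG, of "{v}"] v by simp
      also have "\<dots> = card {e\<in>edges G. (a e = v) \<noteq> (b e = v)}"
        using fin by (simp add: cut_deg_def Int_def)
      also have "\<dots> \<le> card ?S" using S fin by (intro card_mono) (auto simp: incident_edges_def)
      finally show ?thesis using v(2) by (simp add: vertex_degree_def)
    qed
    moreover have "4 * card (splice_partition ?W q ?f ` vertices G) \<le> cross (edges G) a b (splice_partition ?W q ?f) + 4"
      using deficit_partition[OF G R, of 4 0 "splice_partition ?W q ?f"] def by (simp add: zero_enat_def)
    ultimately show ?thesis by (simp add: H)
  qed
  show ?thesis
    unfolding Z3_extendable_at_def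
  proof (intro allI impI, elim conjE)
    fix \<beta> D0
    assume z: "zero_sum G \<beta>" and D0: "orientation_of G ?S D0" and n: "net_outdegree D0 v = \<beta> v"
    have arcs0: "arcs D0 = ?S" using D0 by (simp add: orientation_of_def)
    have ends0: "{tail D0 e, head D0 e} = ends G e" if "e \<in> ?S" for e
      using D0 that by (auto simp: orientation_of_def)
    have finS: "finite ?S" using SE fin finite_subset by blast
    have n0: "net_outdegree D0 x = boundary ?S (tail D0) (head D0) (\<lambda>_. 1) x" for x
      using net_outdegree_boundary[of D0 x] arcs0 finS by simp
    have "(\<Sum>x\<in>vertices G. net_outdegree D0 x) = 0"
      unfolding n0
    proof (rule sum_boundary_closed[OF fin(1)], rule ballI)
      fix e assume e: "e \<in> ?S"
      then have "ends G e \<subseteq> vertices G" using SE G by (auto simp: wf_multigraph_def)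
      then show "(tail D0 e \<in> vertices G) = (head D0 e \<in> vertices G)" using ends0[OF e] by auto
    qed
    \<comment> \<open>The remaining demand vanishes at \<open>v\<close> because \<open>D0\<close>
      already meets the prescription there, so it still sums to zero on the graph without
      \<open>v\<close>.\<close>
    then have "(\<Sum>x\<in>vertices G. \<beta> x - net_outdegree D0 x) = 0"
      using z by (simp add: zero_sum_def sum_subtractf)
    then have "(\<Sum>x\<in>vertices ?H. \<beta> x - net_outdegree D0 x) = 0"
      using n v fin by (simp add: H sum.remove[of "vertices G" v])
    then have "realizable (vertices ?H) (edges ?H) a b (\<lambda>x. \<beta> x - net_outdegree D0 x)"
      by (intro dense_multigraph_realizable[OF GH RH part ec])
    then obtain D1 where D1: "beta_orientation ?H (\<lambda>x. \<beta> x - net_outdegree D0 x) D1"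
      using realizable_beta_orientation[OF GH RH] by blast
    have arcs1: "arcs D1 = edges G - ?S"
      and ends1: "e \<in> edges G - ?S \<Longrightarrow> {tail D1 e, head D1 e} = ends G e"
      and n1: "x \<in> ?W \<Longrightarrow> net_outdegree D1 x = \<beta> x - net_outdegree D0 x" for e x
      using D1 by (auto simp: beta_orientation_def orientation_of_def H)
    define D where "D = \<lparr>verts = vertices G, arcs = edges G,
      tail = (\<lambda>e. if e \<in> ?S then tail D0 e else tail D1 e),
      head = (\<lambda>e. if e \<in> ?S then head D0 e else head D1 e)\<rparr>"
    have net: "net_outdegree D x = net_outdegree D0 x + net_outdegree D1 x" for x
    proof -
      have "net_outdegree D x = boundary (edges G) (tail D) (head D) (\<lambda>_. 1) x"
        using net_outdegree_boundary[of D x] fin by (simp add: D_def)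
      also have "\<dots> = boundary ?S (tail D) (head D) (\<lambda>_. 1) x
          + boundary (edges G - ?S) (tail D) (head D) (\<lambda>_. 1) x"
        by (rule boundary_union[OF fin(2) SE])
      also have "boundary ?S (tail D) (head D) (\<lambda>_. 1) x = net_outdegree D0 x"
        unfolding n0 boundary_def by (intro sum.cong) (auto simp: D_def)
      also have "boundary (edges G - ?S) (tail D) (head D) (\<lambda>_. 1) x = net_outdegree D1 x"
        using net_outdegree_boundary[of D1 x] fin unfolding arcs1 boundary_def
        by (auto simp: D_def intro!: sum.cong)
      finally show ?thesis .
    qed
    have "net_outdegree D1 v = 0"
    proof -
      have "net_outdegree D1 v = boundary (edges G - ?S) (tail D1) (head D1) (\<lambda>_. 1) v"
        using net_outdegree_boundary[of D1 v] fin by (simp add: arcs1)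
      also have "\<dots> = 0"
        unfolding boundary_def
      proof (rule sum.neutral, rule ballI)
        fix e assume e: "e \<in> edges G - ?S"
        then have "v \<notin> {tail D1 e, head D1 e}" unfolding ends1[OF e] by (auto simp: incident_edges_def)
        then show "1 * (of_bool (tail D1 e = v) - of_bool (head D1 e = v)) = (0 :: 3)" by auto
      qed
      finally show ?thesis .
    qed
    then have "\<forall>x\<in>vertices G. net_outdegree D x = \<beta> x" using net n n1 by force
    moreover have "orientation_of G (edges G) D"
      using ends0 ends1 by (auto simp: orientation_of_def D_def)
    moreover have "extends D D0"
      using arcs0 SE by (auto simp: extends_def D_def)
    ultimately show "\<exists>D. beta_orientation G \<beta> D \<and> extends D D0"
      by (auto simp: beta_orientation_def)
  qed
qed

theorem theorem1p9:
  fixes G :: "('v, 'e) multigraph"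
  assumes "wf_multigraph G"
  shows "(spanning_tree_deficit G 4 \<le> 3 \<longrightarrow>
            ((\<nexists>e. bridge G e) \<longrightarrow> Z3_connected G) \<and>
            (Z3_connected G \<longleftrightarrow> edge_connectivity G \<ge> 2)) \<and>
         (spanning_tree_deficit G 4 = 0 \<longrightarrow>
            (\<forall>v \<in> vertices G. vertex_degree G v \<le> 7 \<longrightarrow>
               edge_connectivity (delete_vertex G v) \<ge> 2 \<longrightarrow> Z3_extendable_at G v))"
proof (intro conjI impI ballI)
  fix v assume "spanning_tree_deficit G 4 = 0" "v \<in> vertices G" "vertex_degree G v \<le> 7"
    "edge_connectivity (delete_vertex G v) \<ge> 2"
  then show "Z3_extendable_at G v" by (rule Z3_extendable_at_low_degree[OF assms])
next
  assume "spanning_tree_deficit G 4 \<le> 3"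
  then have def: "spanning_tree_deficit G 4 \<le> enat 3" by (simp add: numeral_eq_enat)
  obtain a b where R: "reference G a b" using ex_reference[OF assms] by blast
  have part: "4 * card (f ` vertices G) \<le> cross (edges G) a b f + 7" for f
    using deficit_partition[OF assms R def, of f] by simp
  \<comment> \<open>Two classes give \<open>8 \<le> cut + 7\<close>, so the deficit bound alone
    makes the graph connected, and only bridges remain to be excluded.\<close>
  have pos: "1 \<le> cut_deg (edges G) a b A" if A: "A \<noteq> {}" "A \<subset> vertices G" for A
  proof -
    have "(\<lambda>v. of_bool (v \<in> A) :: nat) ` vertices G = {0, 1}" using A by (auto simp: image_iff)
    then show ?thesis using part[of "\<lambda>v. of_bool (v \<in> A)"] by (simp add: cross_indicator)
  qed
  have connected: "connected_graph G"
  proof (rule ccontr)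
    assume "\<not> connected_graph G"
    then have "\<not> connected_graph (delete_edges G {})" by (simp add: delete_edges_def)
    from disconnected_cut[OF assms R _ this] obtain A
      where "A \<noteq> {}" "A \<subset> vertices G" "cut_deg (edges G) a b A \<le> 0" by auto
    then show False using pos[of A] by simp
  qed
  have Z: "Z3_connected G" if ec: "2 \<le> edge_connectivity G"
    unfolding Z3_connected_def zero_sum_def
    using realizable_beta_orientation[OF assms R] dense_multigraph_realizable[OF assms R part ec] by blast
  show "Z3_connected G" if "\<nexists>e. bridge G e"
    using Z edge_connectivity_ge_2_iff[OF assms] connected that by blast
  show "Z3_connected G \<longleftrightarrow> edge_connectivity G \<ge> 2"
  proof
    assume "Z3_connected G"
    then have "cut_deg (edges G) a b A \<noteq> 1" if "A \<subset> vertices G" for A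
      using Z3_connected_no_single_cut[OF assms R] that by blast
    then show "2 \<le> edge_connectivity G"
      using pos by (intro edge_connectivity_ge_2I[OF assms R])
        (metis One_nat_def Suc_1 le_antisym not_less_eq_eq)
  qed (rule Z)
qed

end
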